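(* Let $n$ and $k$ be integers with $n\geq 2k\geq 4$. Then $$\chi(\overline{K}(n,k))\leq h_o(\overline{K}(n,k)).$$ Moreover, there exists an integer $t=t(n,k)\geq \chi(\overline{K}(n,k))$ such that $\overline{K}(n,k)$ contains a strongly $1$-shallow $K_t$-minor. Furthermore, if $k\geq 3$, then $$h_o(\overline{K}(n,k))-\chi(\overline{K}(n,k))\geq \begin{cases}\frac{1}{12}\left(1.5^{k-1}-8k-2\right), & \text{if } 2k+1\leq n\leq 3k-2,\\[2pt] \frac{1}{6}\left(1.5^{k-1}-11\right), & \text{if } n=3k-1.\end{cases}$$
   Context: For integers $n\ge 2k\ge 4$, the Kneser graph $K(n,k)$ has as vertices the $k$-element subsets of $[n]=\{1,\dots,n\}$, two being adjacent iff they are disjoint; $\overline{K}(n,k)$ is its complement (two $k$-subsets adjacent iff they are distinct and intersect). $\chi$ denotes chromatic number. A signed graph $(G,\sigma)$ is a graph $G$ with a map $\sigma:E(G)\to\{+,-\}$. Switching at a vertex $x$ changes the sign of every edge incident with $x$; signed graphs obtained from each other by a sequence of switchings are switching equivalent. A signed graph $(H,\pi)$ is a minor of $(G,\sigma)$ if there exist a signature $\tau$ switching equivalent to $\sigma$ and pairwise vertex-disjoint subgraphs $B_x$ of $G$ ($x\in V(H)$) such that (i) for each $x$, the positive edges of $B_x$ under $\tau$ form a connected spanning subgraph of $B_x$, and (ii) for each edge $xy$ of $H$ there is an edge $uv$ of $G$ with $u\in V(B_x)$, $v\in V(B_y)$ and $\tau(uv)=\pi(xy)$. $(G,-)$ denotes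 $G$ with all edges negative. The odd Hadwiger number $h_o(G)$ is the largest $t$ such that $(K_t,-)$ is a minor of $(G,-)$. A $K_t$-minor of a graph $G$ is given by $t$ pairwise vertex-disjoint connected subgraphs (bags) of $G$, any two of which are joined by an edge of $G$. A star is $K_{1,s}$ for some $s\ge1$. A $K_t$-minor is strongly $1$-shallow if each bag is either a single vertex or a star, and for every two bags there is a connecting edge of $G$ each of whose endpoints is either the unique vertex of a single-vertex bag or a leaf vertex of a star bag. *)

theory Defs
  imports Complex_Main
begin

text \<open>Simple graphs are given by a vertex set V and a symmetric irreflexive
adjacency relation E (only its restriction to V matters).\<close>

definition Kbar_V :: "nat \<Rightarrow> nat \<Rightarrow> nat set set" where
  "Kbar_V n k = {S. S \<subseteq> {1..n} \<and> card S = k}"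

definition Kbar_E :: "nat set \<Rightarrow> nat set \<Rightarrow> bool" where
  "Kbar_E S T \<longleftrightarrow> S \<noteq> T \<and> S \<inter> T \<noteq> {}"

definition proper_colouring :: "'a set \<Rightarrow> ('a \<Rightarrow> 'a \<Rightarrow> bool) \<Rightarrow> nat \<Rightarrow> ('a \<Rightarrow> nat) \<Rightarrow> bool" where
  "proper_colouring V E c f \<longleftrightarrow>
     (\<forall>v\<in>V. f v < c) \<and> (\<forall>u\<in>V. \<forall>v\<in>V. E u v \<longrightarrow> f u \<noteq> f v)"

definition chromatic_number :: "'a set \<Rightarrow> ('a \<Rightarrow> 'a \<Rightarrow> bool) \<Rightarrow> nat" where
  "chromatic_number V E = (LEAST c. \<exists>f. proper_colouring V E c f)"

definition connected_graph :: "'a set \<Rightarrow> ('a \<Rightarrow> 'a \<Rightarrow> bool) \<Rightarrow> bool" where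
  "connected_graph W R \<longleftrightarrow> W \<noteq> {} \<and>
     (\<forall>u\<in>W. \<forall>v\<in>W. (\<lambda>a b. a \<in> W \<and> b \<in> W \<and> R a b)\<^sup>*\<^sup>* u v)"

definition subgraph :: "'a set \<Rightarrow> ('a \<Rightarrow> 'a \<Rightarrow> bool) \<Rightarrow> 'a set \<Rightarrow> ('a \<Rightarrow> 'a \<Rightarrow> bool) \<Rightarrow> bool" where
  "subgraph W F V E \<longleftrightarrow> W \<subseteq> V \<and>
     (\<forall>u v. F u v \<longrightarrow> u \<in> W \<and> v \<in> W \<and> E u v \<and> F v u)"

text \<open>Signatures: a signature is a function on pairs of vertices, True meaning
positive and False meaning negative; only its values on edges matter.
Switching at x flips the sign of every edge incident with x.\<close>
definition switch_at :: "'a \<Rightarrow> ('a \<Rightarrow> 'a \<Rightarrow> bool) \<Rightarrow> ('a \<Rightarrow> 'a \<Rightarrow> bool)" where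
  "switch_at x \<sigma> = (\<lambda>u v. if (u = x) \<noteq> (v = x) then \<not> \<sigma> u v else \<sigma> u v)"

inductive switch_equiv :: "'a set \<Rightarrow> ('a \<Rightarrow> 'a \<Rightarrow> bool) \<Rightarrow> ('a \<Rightarrow> 'a \<Rightarrow> bool) \<Rightarrow> bool"
  for V where
  se_refl: "switch_equiv V \<sigma> \<sigma>"
| se_step: "switch_equiv V \<sigma> \<tau> \<Longrightarrow> x \<in> V \<Longrightarrow> switch_equiv V \<sigma> (switch_at x \<tau>)"

definition signed_minor ::
  "'b set \<Rightarrow> ('b \<Rightarrow> 'b \<Rightarrow> bool) \<Rightarrow> ('b \<Rightarrow> 'b \<Rightarrow> bool) \<Rightarrow>
   'a set \<Rightarrow> ('a \<Rightarrow> 'a \<Rightarrow> bool) \<Rightarrow> ('a \<Rightarrow> 'a \<Rightarrow> bool) \<Rightarrow> bool" where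
  "signed_minor VH EH \<pi> VG EG \<sigma> \<longleftrightarrow>
     (\<exists>\<tau> W F. switch_equiv VG \<sigma> \<tau> \<and>
        (\<forall>x\<in>VH. subgraph (W x) (F x) VG EG) \<and>
        (\<forall>x\<in>VH. \<forall>y\<in>VH. x \<noteq> y \<longrightarrow> W x \<inter> W y = {}) \<and>
        (\<forall>x\<in>VH. connected_graph (W x) (\<lambda>u v. F x u v \<and> \<tau> u v)) \<and>
        (\<forall>x\<in>VH. \<forall>y\<in>VH. EH x y \<longrightarrow>
           (\<exists>u\<in>W x. \<exists>v\<in>W y. EG u v \<and> \<tau> u v = \<pi> x y)))"

definition odd_hadwiger :: "'a set \<Rightarrow> ('a \<Rightarrow> 'a \<Rightarrow> bool) \<Rightarrow> nat" where
  "odd_hadwiger V E =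
     (GREATEST t. signed_minor {..<t} (\<lambda>x y. x \<noteq> y) (\<lambda>_ _. False) V E (\<lambda>_ _. False))"

definition star_bag :: "'a set \<Rightarrow> ('a \<Rightarrow> 'a \<Rightarrow> bool) \<Rightarrow> bool" where
  "star_bag W F \<longleftrightarrow> card W \<ge> 2 \<and> finite W \<and>
     (\<exists>c\<in>W. \<forall>u v. F u v \<longleftrightarrow> (u = c \<and> v \<in> W - {c}) \<or> (v = c \<and> u \<in> W - {c}))"

definition good_end :: "'a set \<Rightarrow> ('a \<Rightarrow> 'a \<Rightarrow> bool) \<Rightarrow> 'a \<Rightarrow> bool" where
  "good_end W F v \<longleftrightarrow> W = {v} \<or> (star_bag W F \<and> v \<in> W \<and> card {w \<in> W. F v w} = 1)"

definition strongly_1_shallow_Kt_minor :: "'a set \<Rightarrow> ('a \<Rightarrow> 'a \<Rightarrow> bool) \<Rightarrow> nat \<Rightarrow> bool" where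
  "strongly_1_shallow_Kt_minor V E t \<longleftrightarrow>
     (\<exists>W F. (\<forall>i<t. subgraph (W i) (F i) V E) \<and>
        (\<forall>i<t. \<forall>j<t. i \<noteq> j \<longrightarrow> W i \<inter> W j = {}) \<and>
        (\<forall>i<t. connected_graph (W i) (F i)) \<and>
        (\<forall>i<t. (\<exists>v. W i = {v}) \<or> star_bag (W i) (F i)) \<and>
        (\<forall>i<t. \<forall>j<t. i \<noteq> j \<longrightarrow>
           (\<exists>u\<in>W i. \<exists>v\<in>W j. E u v \<and> good_end (W i) (F i) u \<and> good_end (W j) (F j) v)))"

end

theory Submission
  imports Defs
begin

text \<open>By Baranyai's theorem the chromatic number is at most \<open>\<lceil>C(n, k) / \<lfloor>n / k\<rfloor>\<rceil>\<close>. For the minor, take the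
  \<open>C(n - 1, k - 1)\<close> sets containing \<open>1\<close> as single vertices and add stars inside \<open>{2..n}\<close> whose leaves
  miss at most \<open>k - 2\<close> points of \<open>{2..n}\<close>: their leaves then meet each other and every set containing
  \<open>1\<close>. If \<open>k\<close> divides \<open>n\<close>, no star is needed. If \<open>2k < n < 3k\<close>, the leaves of a star are two disjoint
  sets forming a class of Baranyai's decomposition of the \<open>k\<close>-subsets of \<open>{2..n}\<close>, and centres meeting
  both are so frequent that they can be chosen greedily; this yields about one third of these subsets
  as stars, hence the exponential gain. If \<open>n > 3k\<close> and
  \<open>k \<ge> 3\<close>, each star has an apex \<open>x \<in> {2, 3, 4}\<close> that belongs
  to its centre and to all its leaves; the leaves minus \<open>x\<close> form a class of Baranyai's decomposition of
  the \<open>(k - 1)\<close>-subsets of \<open>{5..n}\<close> enlarged by the cyclic successor of \<open>x\<close>, so that stars with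
  different apexes are disjoint. For \<open>k = 2\<close> and odd \<open>n\<close> a single star suffices.\<close>

section \<open>Hall's theorem and integral rounding\<close>

text \<open>Induction on \<open>card A\<close>. If some nonempty proper subset \<open>B\<close> is
  tight, having exactly \<open>card B\<close> neighbours, then \<open>B\<close> and
  \<open>A - B\<close> are matched separately. Otherwise every nonempty proper subset has a
  neighbour to spare, and any one pair may be fixed and removed.\<close>

theorem hall_marriage:
  fixes N :: "'a \<Rightarrow> 'b set"
  assumes "finite A" and "\<And>x. x \<in> A \<Longrightarrow> finite (N x)"
    and "\<And>B. B \<subseteq> A \<Longrightarrow> card B \<le> card (\<Union>(N ` B))"
  shows "\<exists>h. inj_on h A \<and> (\<forall>x\<in>A. h x \<in> N x)"
  using assms
proof (induction "card A" arbitrary: A N rule: less_induct)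
  case less
  note fin = less.prems(1) and finN = less.prems(2) and hall = less.prems(3)
  have finU: "finite (\<Union>(N ` B))" if "B \<subseteq> A" for B
    using that finN finite_subset[OF that fin] by auto
  show ?case
  proof (cases "\<exists>B. B \<subset> A \<and> B \<noteq> {} \<and> card B = card (\<Union>(N ` B))")
    case True
    then obtain B where B: "B \<subset> A" "B \<noteq> {}" "card B = card (\<Union>(N ` B))" by blast
    have finB: "finite B" using B(1) fin by (meson finite_subset psubset_imp_subset)
    have "\<exists>h. inj_on h B \<and> (\<forall>x\<in>B. h x \<in> N x)"
      by (rule less.hyps[OF psubset_card_mono[OF fin B(1)]]) (use B(1) finN finB hall in auto)
    then obtain h1 where h1: "inj_on h1 B" "\<forall>x\<in>B. h1 x \<in> N x" by blast
    define N' where "N' x = N x - \<Union>(N ` B)" for x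
    have "\<exists>h. inj_on h (A - B) \<and> (\<forall>x\<in>A - B. h x \<in> N' x)"
    proof (rule less.hyps)
      show "card (A - B) < card A"
        using B(1,2) fin by (intro psubset_card_mono) auto
      show "finite (A - B)" using fin by simp
      show "finite (N' x)" if "x \<in> A - B" for x using that finN by (simp add: N'_def)
      fix C assume C: "C \<subseteq> A - B"
      have finC: "finite C" using C fin by (meson finite_Diff finite_subset)
      \<comment> \<open>Hall's condition for the rest: apply the given one to
        \<open>C \<union> B\<close> and subtract the tight part.\<close>
      have "card C + card B = card (C \<union> B)" using C finC finB by (subst card_Un_disjoint) auto
      also have "\<dots> \<le> card (\<Union>(N ` (C \<union> B)))" using hall[of "C \<union> B"] C B by blast
      also have "\<Union>(N ` (C \<union> B)) = \<Union>(N' ` C) \<union> \<Union>(N ` B)" by (auto simp: N'_def)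
      also have "card \<dots> \<le> card (\<Union>(N' ` C)) + card (\<Union>(N ` B))" by (rule card_Un_le)
      finally show "card C \<le> card (\<Union>(N' ` C))" using B(3) by simp
    qed
    then obtain h2 where h2: "inj_on h2 (A - B)" "\<forall>x\<in>A - B. h2 x \<in> N' x" by blast
    let ?h = "\<lambda>x. if x \<in> B then h1 x else h2 x"
    have "inj_on ?h A"
    proof (rule inj_onI)
      fix x y assume xy: "x \<in> A" "y \<in> A" "?h x = ?h y"
      have sep: "h1 u \<noteq> h2 v" if "u \<in> B" "v \<in> A - B" for u v
      proof -
        have "h1 u \<in> N u" "h2 v \<in> N' v" using that h1(2) h2(2) by simp_all
        then show ?thesis using that(1) by (auto simp: N'_def)
      qed
      consider "x \<in> B" "y \<in> B" | "x \<in> B" "y \<notin> B" | "x \<notin> B" "y \<in> B" | "x \<notin> B" "y \<notin> B" by blast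
      then show "x = y"
      proof cases
        case 1 then show ?thesis using xy h1(1) by (simp add: inj_on_eq_iff)
      next
        case 2 then show ?thesis using xy sep[of x y] by simp
      next
        case 3 then show ?thesis using xy sep[of y x] by simp
      next
        case 4 then show ?thesis using xy h2(1) by (simp add: inj_on_eq_iff)
      qed
    qed
    moreover have "\<forall>x\<in>A. ?h x \<in> N x" using h1 h2 by (auto simp: N'_def)
    ultimately show ?thesis by blast
  next
    case False
    show ?thesis
    proof (cases "A = {}")
      case True then show ?thesis by auto
    next
      case nonempty: False
      then obtain a where a: "a \<in> A" by blast
      have "card {a} \<le> card (\<Union>(N ` {a}))" using hall[of "{a}"] a by blast
      then have "N a \<noteq> {}" by auto
      then obtain b where b: "b \<in> N a" by blast
      define N' where "N' x = N x - {b}" for x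
      have "\<exists>h. inj_on h (A - {a}) \<and> (\<forall>x\<in>A - {a}. h x \<in> N' x)"
      proof (rule less.hyps)
        show "card (A - {a}) < card A" by (rule card_Diff1_less[OF fin a])
        show "finite (A - {a})" using fin by simp
        show "finite (N' x)" if "x \<in> A - {a}" for x using that finN by (simp add: N'_def)
        fix C assume C: "C \<subseteq> A - {a}"
        show "card C \<le> card (\<Union>(N' ` C))"
        proof (cases "C = {}")
          case True then show ?thesis by simp
        next
          case ne: False
          have "C \<subset> A" using C a by blast
          then have "card C < card (\<Union>(N ` C))"
            using False ne hall[of C] by (metis le_neq_implies_less psubset_imp_subset)
          moreover have "\<Union>(N' ` C) = \<Union>(N ` C) - {b}" by (auto simp: N'_def)
          moreover have "card (\<Union>(N ` C) - {b}) \<ge> card (\<Union>(N ` C)) - 1"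
            by (simp add: card_Diff_singleton_if)
          ultimately show ?thesis by simp
        qed
      qed
      then obtain h where h: "inj_on h (A - {a})" "\<forall>x\<in>A - {a}. h x \<in> N' x" by blast
      have "b \<notin> h ` (A - {a})" using h(2) by (auto simp: N'_def)
      then have "inj_on (h(a := b)) (insert a (A - {a}))"
        using h(1) by (subst inj_on_insert) (auto simp: inj_on_def)
      then have "inj_on (h(a := b)) A" using a by (simp add: insert_absorb)
      moreover have "\<forall>x\<in>A. (h(a := b)) x \<in> N x" using h b by (auto simp: N'_def)
      ultimately show ?thesis by blast
    qed
  qed
qed

text \<open>The condition under which a greedy choice works. It implies Hall's condition because a
  single neighbourhood is already as large as all of \<open>A\<close>.\<close>

lemma ex_inj_choice:
  fixes N :: "'a \<Rightarrow> 'b set"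
  assumes "finite A" and "\<And>x. x \<in> A \<Longrightarrow> finite (N x)" and "\<And>x. x \<in> A \<Longrightarrow> card A \<le> card (N x)"
  shows "\<exists>h. inj_on h A \<and> (\<forall>x\<in>A. h x \<in> N x)"
proof (rule hall_marriage)
  fix B assume B: "B \<subseteq> A"
  show "card B \<le> card (\<Union>(N ` B))"
  proof (cases "B = {}")
    case False
    then obtain x where x: "x \<in> B" by blast
    have "finite B" using B assms(1) finite_subset by blast
    then have "card (N x) \<le> card (\<Union>(N ` B))"
      using x B assms(2) by (intro card_mono) auto
    moreover have "card B \<le> card A" using B assms(1) by (rule card_mono[rotated])
    moreover have "card A \<le> card (N x)" using x B assms(3) by blast
    ultimately show ?thesis by linarith
  qed simp
qed (use assms in auto)

text \<open>A perfect matching decides, for each element, between one of the slots that its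
  \<open>g\<close>-fibre reserves for chosen elements and one of those that its \<open>f\<close>-fibre reserves for rejected
  ones; the weights \<open>w x\<close> and \<open>q - w x\<close> are a fractional such matching.\<close>

lemma integral_rounding:
  fixes w :: "'a \<Rightarrow> nat" and f :: "'a \<Rightarrow> 'b" and g :: "'a \<Rightarrow> 'c"
  assumes fin: "finite X" and q: "0 < q" and wq: "\<And>x. x \<in> X \<Longrightarrow> w x \<le> q"
    and row: "\<And>i. i \<in> f ` X \<Longrightarrow> (\<Sum>x | x \<in> X \<and> f x = i. w x) = a i * q"
    and col: "\<And>j. j \<in> g ` X \<Longrightarrow> (\<Sum>x | x \<in> X \<and> g x = j. w x) = b j * q"
  obtains Y where "Y \<subseteq> X"
    "\<And>i. i \<in> f ` X \<Longrightarrow> card {x \<in> Y. f x = i} = a i"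
    "\<And>j. j \<in> g ` X \<Longrightarrow> card {x \<in> Y. g x = j} = b j"
    "\<And>x. x \<in> Y \<Longrightarrow> 0 < w x" "\<And>x. x \<in> X \<Longrightarrow> w x = q \<Longrightarrow> x \<in> Y"
proof -
  define r where "r i = card {x \<in> X. f x = i}" for i
  have ar: "a i \<le> r i" and rest: "(\<Sum>x | x \<in> X \<and> f x = i. q - w x) = (r i - a i) * q" if "i \<in> f ` X" for i
  proof -
    have "(\<Sum>x | x \<in> X \<and> f x = i. w x) \<le> (\<Sum>x | x \<in> X \<and> f x = i. q)" by (intro sum_mono) (use wq in auto)
    then show "a i \<le> r i" using row[OF that] q by (simp add: r_def)
    have "(\<Sum>x | x \<in> X \<and> f x = i. q - w x) = (\<Sum>x | x \<in> X \<and> f x = i. q) - (\<Sum>x | x \<in> X \<and> f x = i. w x)"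
      by (rule sum_subtractf_nat) (use wq in auto)
    then show "(\<Sum>x | x \<in> X \<and> f x = i. q - w x) = (r i - a i) * q"
      using row[OF that] by (simp add: r_def diff_mult_distrib)
  qed
  \<comment> \<open>\<open>P\<close> and \<open>R\<close> hold the slots for chosen and for rejected
    elements. Weight \<open>0\<close> excludes choosing and weight \<open>q\<close> excludes
    rejecting, which yields the last two claims on \<open>Y\<close>.\<close>
  define P :: "'a \<Rightarrow> ('c \<times> nat + 'b \<times> nat) set"
    where "P x = (if 0 < w x then (\<lambda>c. Inl (g x, c)) ` {..<b (g x)} else {})" for x
  define R :: "'a \<Rightarrow> ('c \<times> nat + 'b \<times> nat) set"
    where "R x = (if w x < q then (\<lambda>c. Inr (f x, c)) ` {..<r (f x) - a (f x)} else {})" for x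
  have "\<exists>h. inj_on h X \<and> (\<forall>x\<in>X. h x \<in> P x \<union> R x)"
  proof (rule hall_marriage[OF fin])
    show "finite (P x \<union> R x)" for x by (simp add: P_def R_def)
    fix B assume B: "B \<subseteq> X"
    have finB: "finite B" using B fin finite_subset by blast
    define B1 where "B1 = {x \<in> B. 0 < w x}"
    define B2 where "B2 = {x \<in> B. w x < q}"
    have fin12: "finite B1" "finite B2" using finB by (auto simp: B1_def B2_def)
    have P_Un: "\<Union>(P ` B) = Inl ` (SIGMA j : g ` B1. {..<b j})"
      by (auto simp: P_def B1_def split: if_splits)
    have R_Un: "\<Union>(R ` B) = Inr ` (SIGMA i : f ` B2. {..<r i - a i})"
      by (auto simp: R_def B2_def split: if_splits)
    have "\<Union>((\<lambda>x. P x \<union> R x) ` B) = \<Union>(P ` B) \<union> \<Union>(R ` B)" by auto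
    moreover have "card (\<Union>(P ` B) \<union> \<Union>(R ` B)) = card (\<Union>(P ` B)) + card (\<Union>(R ` B))"
      by (rule card_Un_disjoint) (use fin12 in \<open>auto simp: P_Un R_Un\<close>)
    moreover have "card (\<Union>(P ` B)) = (\<Sum>j\<in>g ` B1. b j)"
      unfolding P_Un using fin12 by (subst card_image) auto
    moreover have "card (\<Union>(R ` B)) = (\<Sum>i\<in>f ` B2. r i - a i)"
      unfolding R_Un using fin12 by (subst card_image) auto
    ultimately have c: "card (\<Union>((\<lambda>x. P x \<union> R x) ` B)) = (\<Sum>j\<in>g ` B1. b j) + (\<Sum>i\<in>f ` B2. r i - a i)"
      by simp
    \<comment> \<open>Hall's condition by double counting: every element carries total weight
      \<open>q\<close>, split into \<open>w x\<close> and \<open>q - w x\<close>. Only elements with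
      slots on a side contribute there, and the weight in a fibre is at most \<open>q\<close> times
      the number of its slots.\<close>
    have "card B * q = (\<Sum>x\<in>B. w x + (q - w x))"
      using B wq by (subst sum.cong[OF refl, of _ _ "\<lambda>_. q"]) auto
    also have "\<dots> = (\<Sum>x\<in>B. w x) + (\<Sum>x\<in>B. q - w x)" by (rule sum.distrib)
    also have "(\<Sum>x\<in>B. w x) = (\<Sum>x\<in>B1. w x)"
      by (rule sum.mono_neutral_right) (use finB in \<open>auto simp: B1_def\<close>)
    also have "\<dots> = (\<Sum>j\<in>g ` B1. \<Sum>x | x \<in> B1 \<and> g x = j. w x)"
      using sum.image_gen[OF fin12(1), of w g] by simp
    also have "\<dots> \<le> (\<Sum>j\<in>g ` B1. b j * q)"
    proof (rule sum_mono)
      fix j assume j: "j \<in> g ` B1"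
      have "(\<Sum>x | x \<in> B1 \<and> g x = j. w x) \<le> (\<Sum>x | x \<in> X \<and> g x = j. w x)"
        by (rule sum_mono2) (use fin B in \<open>auto simp: B1_def\<close>)
      then show "(\<Sum>x | x \<in> B1 \<and> g x = j. w x) \<le> b j * q" using col[of j] j B by (auto simp: B1_def)
    qed
    also have "(\<Sum>x\<in>B. q - w x) = (\<Sum>x\<in>B2. q - w x)"
      by (rule sum.mono_neutral_right) (use finB in \<open>auto simp: B2_def\<close>)
    also have "\<dots> = (\<Sum>i\<in>f ` B2. \<Sum>x | x \<in> B2 \<and> f x = i. q - w x)"
      using sum.image_gen[OF fin12(2), of "\<lambda>x. q - w x" f] by simp
    also have "\<dots> \<le> (\<Sum>i\<in>f ` B2. (r i - a i) * q)"
    proof (rule sum_mono)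
      fix i assume i: "i \<in> f ` B2"
      have "(\<Sum>x | x \<in> B2 \<and> f x = i. q - w x) \<le> (\<Sum>x | x \<in> X \<and> f x = i. q - w x)"
        by (rule sum_mono2) (use fin B in \<open>auto simp: B2_def\<close>)
      then show "(\<Sum>x | x \<in> B2 \<and> f x = i. q - w x) \<le> (r i - a i) * q"
        using rest[of i] i B by (auto simp: B2_def)
    qed
    finally have "card B * q \<le> ((\<Sum>j\<in>g ` B1. b j) + (\<Sum>i\<in>f ` B2. r i - a i)) * q"
      by (simp add: sum_distrib_right distrib_right)
    then show "card B \<le> card (\<Union>((\<lambda>x. P x \<union> R x) ` B))" using q c by simp
  qed
  then obtain h where inj: "inj_on h X" and h: "\<And>x. x \<in> X \<Longrightarrow> h x \<in> P x \<union> R x" by blast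
  define Y where "Y = {x \<in> X. h x \<in> P x}"
  have finY: "finite Y" using fin by (simp add: Y_def)
  have YX: "Y \<subseteq> X" by (auto simp: Y_def)
  have up: "card {x \<in> Y. g x = j} \<le> b j" for j
  proof -
    have "card {x \<in> Y. g x = j} \<le> card ((\<lambda>c. Inl (j, c) :: ('c \<times> nat) + ('b \<times> nat)) ` {..<b j})"
    proof (rule card_inj_on_le)
      show "inj_on h {x \<in> Y. g x = j}" by (rule inj_on_subset[OF inj]) (use YX in auto)
      show "h ` {x \<in> Y. g x = j} \<subseteq> (\<lambda>c. Inl (j, c)) ` {..<b j}"
        by (auto simp: P_def Y_def split: if_splits)
    qed simp
    then show ?thesis by (simp add: card_image inj_on_def)
  qed
  have low: "a i \<le> card {x \<in> Y. f x = i}" if i: "i \<in> f ` X" for i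
  proof -
    have "card {x \<in> X - Y. f x = i} \<le> card ((\<lambda>c. Inr (i, c) :: ('c \<times> nat) + ('b \<times> nat)) ` {..<r i - a i})"
    proof (rule card_inj_on_le)
      show "inj_on h {x \<in> X - Y. f x = i}" using inj by (rule inj_on_subset) auto
      have "h x \<in> R x" if "x \<in> X - Y" for x using h[of x] that by (auto simp: Y_def)
      then show "h ` {x \<in> X - Y. f x = i} \<subseteq> (\<lambda>c. Inr (i, c)) ` {..<r i - a i}"
        by (force simp: R_def split: if_splits)
    qed simp
    then have "card {x \<in> X - Y. f x = i} \<le> r i - a i" by (simp add: card_image inj_on_def)
    moreover have "r i = card {x \<in> Y. f x = i} + card {x \<in> X - Y. f x = i}"
      unfolding r_def using fin finY YX
      by (subst card_Un_disjoint[symmetric]) (auto intro!: arg_cong[where f = card])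
    ultimately show ?thesis using ar[OF i] by linarith
  qed
  have Ysum: "card Y = (\<Sum>i\<in>f ` X. card {x \<in> Y. f x = i})" "card Y = (\<Sum>j\<in>g ` X. card {x \<in> Y. g x = j})"
    using sum.group[OF finY _ image_mono[OF YX], of f "\<lambda>_. 1::nat"]
      sum.group[OF finY _ image_mono[OF YX], of g "\<lambda>_. 1::nat"] fin
    by simp_all
  have "(\<Sum>i\<in>f ` X. a i) * q = (\<Sum>j\<in>g ` X. b j) * q"
    using sum.image_gen[OF fin, of w f] sum.image_gen[OF fin, of w g] row col
    by (simp add: sum_distrib_right)
  then have ab: "(\<Sum>i\<in>f ` X. a i) = (\<Sum>j\<in>g ` X. b j)" using q by simp
  have "card Y \<le> (\<Sum>j\<in>g ` X. b j)" unfolding Ysum(2) by (intro sum_mono up)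
  moreover have "(\<Sum>i\<in>f ` X. a i) \<le> card Y" unfolding Ysum(1) by (intro sum_mono low)
  ultimately have tot: "card Y = (\<Sum>j\<in>g ` X. b j)" "card Y = (\<Sum>i\<in>f ` X. a i)" using ab by auto
  \<comment> \<open>Injectivity of \<open>h\<close> gives only the one-sided bounds
    \<open>up\<close> and \<open>low\<close>. By \<open>ab\<close> both sum to the same total, so
    each of them is attained.\<close>
  have eqf: "card {x \<in> Y. f x = i} = a i" if i: "i \<in> f ` X" for i
  proof (rule ccontr)
    assume "card {x \<in> Y. f x = i} \<noteq> a i"
    then have "a i < card {x \<in> Y. f x = i}" using low[OF i] by simp
    then have "(\<Sum>i\<in>f ` X. a i) < (\<Sum>i\<in>f ` X. card {x \<in> Y. f x = i})"
      by (intro sum_strict_mono_ex1) (use fin low i in auto)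
    then show False using tot Ysum by simp
  qed
  have eqg: "card {x \<in> Y. g x = j} = b j" if j: "j \<in> g ` X" for j
  proof (rule ccontr)
    assume "card {x \<in> Y. g x = j} \<noteq> b j"
    then have "card {x \<in> Y. g x = j} < b j" using up[of j] by simp
    then have "(\<Sum>j\<in>g ` X. card {x \<in> Y. g x = j}) < (\<Sum>j\<in>g ` X. b j)"
      by (intro sum_strict_mono_ex1) (use fin up j in auto)
    then show False using tot Ysum by simp
  qed
  show thesis
  proof (rule that[OF YX eqf eqg])
    show "0 < w x" if "x \<in> Y" for x using that by (auto simp: Y_def P_def split: if_splits)
    show "x \<in> Y" if "x \<in> X" "w x = q" for x using that h[of x] by (auto simp: Y_def R_def)
  qed
qed

section \<open>Baranyai's theorem\<close>

text \<open>Stage \<open>l\<close> of Baranyai's construction: the member \<open>S (i, j)\<close> of class \<open>i\<close> is the trace on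
  \<open>{..<l}\<close> of a \<open>K\<close>-set yet to be completed, and \<open>e i\<close> counts the points \<open>x \<ge> l\<close> whose degree in
  class \<open>i\<close> will be \<open>D i - 1\<close> instead of \<open>D i\<close>. In the next step every trace \<open>Z\<close> wants to receive
  the point \<open>l\<close> with weight \<open>(K - card Z) / (n - l)\<close>, and these weights get rounded.\<close>

definition baranyai_stage ::
  "nat \<Rightarrow> nat \<Rightarrow> nat \<Rightarrow> (nat \<Rightarrow> nat) \<Rightarrow> (nat \<Rightarrow> nat) \<Rightarrow> nat \<Rightarrow> nat \<Rightarrow> (nat \<times> nat \<Rightarrow> nat set) \<Rightarrow> (nat \<Rightarrow> nat) \<Rightarrow> bool"
  where "baranyai_stage n K t s D m l S e \<longleftrightarrow>
    (\<forall>x \<in> Sigma {..<t} (\<lambda>i. {..<s i}). S x \<subseteq> {..<l}) \<and>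
    (\<forall>Z \<subseteq> {..<l}. card {x \<in> Sigma {..<t} (\<lambda>i. {..<s i}). S x = Z} =
       (if card Z \<le> K then (n - l) choose (K - card Z) else 0)) \<and>
    (\<forall>i<t. e i \<le> n - l) \<and>
    (\<forall>i<t. (\<Sum>j<s i. K - card (S (i, j))) + e i = D i * (n - l)) \<and>
    (\<Sum>i<t. e i) = m * (n - l) \<and>
    (\<forall>i<t. \<forall>x<l. D i \<le> card {j. j < s i \<and> x \<in> S (i, j)} + 1 \<and> card {j. j < s i \<and> x \<in> S (i, j)} \<le> D i)"

text \<open>The weights form an array whose rows are the classes and whose columns are the distinct
  traces. All row and column sums are multiples of \<open>q = n - l\<close>, so
  \<open>integral_rounding\<close> selects the traces that receive the point
  \<open>l\<close>.\<close>

lemma baranyai_stage_Suc: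
  assumes stage: "baranyai_stage n K t s D m l S e" and l: "l < n"
  shows "\<exists>S' e'. baranyai_stage n K t s D m (Suc l) S' e'"
proof -
  define A where "A = Sigma {..<t} (\<lambda>i. {..<s i})"
  \<comment> \<open>Each class \<open>i\<close> gets a dummy entry \<open>(i, s i)\<close> of weight
    \<open>e i\<close>. Selecting it means that \<open>l\<close> has degree \<open>D i - 1\<close>
    in class \<open>i\<close>. The dummies form the column \<open>None\<close>.\<close>
  define X where "X = Sigma {..<t} (\<lambda>i. {..s i})"
  define q where "q = n - l"
  have finA: "finite A" and finX: "finite X" by (auto simp: A_def X_def)
  have q: "0 < q" using l by (simp add: q_def)
  have q': "n - Suc l = q - 1" by (simp add: q_def)
  have S: "\<And>x. x \<in> A \<Longrightarrow> S x \<subseteq> {..<l}"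
    and cnt: "\<And>Z. Z \<subseteq> {..<l} \<Longrightarrow> card {x \<in> A. S x = Z} = (if card Z \<le> K then q choose (K - card Z) else 0)"
    and e: "\<And>i. i < t \<Longrightarrow> e i \<le> q"
    and rowsum: "\<And>i. i < t \<Longrightarrow> (\<Sum>j<s i. K - card (S (i, j))) + e i = D i * q"
    and esum: "(\<Sum>i<t. e i) = m * q"
    and deg: "\<And>i x. i < t \<Longrightarrow> x < l \<Longrightarrow> D i \<le> card {j. j < s i \<and> x \<in> S (i, j)} + 1 \<and> card {j. j < s i \<and> x \<in> S (i, j)} \<le> D i"
    using stage[unfolded baranyai_stage_def, folded A_def q_def] by blast+
  \<comment> \<open>A trace that occurs has a nonzero count, so its binomial coefficient does not
    vanish and at most \<open>q\<close> points are missing.\<close>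
  have cardS: "K - card (S x) \<le> q" if x: "x \<in> A" for x
  proof -
    have "card {x} \<le> card {y \<in> A. S y = S x}" by (rule card_mono) (use x finA in auto)
    then have "card {y \<in> A. S y = S x} \<noteq> 0" by simp
    then have "(if card (S x) \<le> K then q choose (K - card (S x)) else 0) \<noteq> 0" using cnt[OF S[OF x]] by simp
    then show ?thesis by (auto split: if_splits simp: not_less[symmetric] binomial_eq_0)
  qed
  define w where "w x = (if snd x < s (fst x) then K - card (S x) else e (fst x))" for x :: "nat \<times> nat"
  define g where "g x = (if snd x < s (fst x) then Some (S x) else None)" for x :: "nat \<times> nat"
  define b where "b z = (case z of None \<Rightarrow> m | Some Z \<Rightarrow> (if card Z < K then (q - 1) choose (K - card Z - 1) else 0))" for z :: "nat set option"
  \<comment> \<open>The absorption identity: the column of \<open>Z\<close> has weight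
    \<open>q\<close> times the number of \<open>K\<close>-sets whose trace is \<open>Z\<close>
    together with \<open>l\<close>.\<close>
  have colA: "card {x \<in> A. S x = Z} * (K - card Z) = b (Some Z) * q" if "Z \<subseteq> {..<l}" for Z
  proof (cases "card Z < K")
    case True
    then have "(K - card Z) * (q choose (K - card Z)) = q * ((q - 1) choose (K - card Z - 1))"
      by (intro times_binomial_minus1_eq) simp
    then show ?thesis using True cnt[OF that] by (simp add: b_def mult.commute)
  next
    case False then show ?thesis by (simp add: b_def)
  qed
  have gSome: "{x \<in> X. g x = Some Z} = {x \<in> A. S x = Z}" for Z
    by (auto simp: X_def A_def g_def split: if_splits)
  have row_set: "{x \<in> X. fst x = i} = Pair i ` insert (s i) {..<s i}" if "i < t" for i
    using that by (auto simp: X_def image_iff)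
  obtain Y where YX: "Y \<subseteq> X"
    and Yrow: "\<And>i. i \<in> fst ` X \<Longrightarrow> card {x \<in> Y. fst x = i} = D i"
    and Ycol: "\<And>j. j \<in> g ` X \<Longrightarrow> card {x \<in> Y. g x = j} = b j"
    and Ypos: "\<And>x. x \<in> Y \<Longrightarrow> 0 < w x" and Yfull: "\<And>x. x \<in> X \<Longrightarrow> w x = q \<Longrightarrow> x \<in> Y"
  proof (rule integral_rounding[of X q w fst D g b])
    show "w x \<le> q" if "x \<in> X" for x
      using that cardS e by (auto simp: w_def X_def A_def)
    show "(\<Sum>x | x \<in> X \<and> fst x = i. w x) = D i * q" if "i \<in> fst ` X" for i
    proof -
      have i: "i < t" using that by (auto simp: X_def)
      show ?thesis unfolding row_set[OF i] using rowsum[OF i]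
        by (subst sum.reindex) (auto simp: inj_on_def w_def add.commute)
    qed
    show "(\<Sum>x | x \<in> X \<and> g x = j. w x) = b j * q" if "j \<in> g ` X" for j
    proof (cases j)
      case None
      have "{x \<in> X. g x = None} = (\<lambda>i. (i, s i)) ` {..<t}"
        by (auto simp: X_def g_def split: if_splits)
      then show ?thesis using None esum
        by (simp add: sum.reindex inj_on_def w_def b_def)
    next
      case (Some Z)
      then have "Some Z \<in> g ` X" using that by simp
      then obtain x where "Some Z = g x" "x \<in> X" by (rule imageE)
      then have "x \<in> {x \<in> X. g x = Some Z}" by simp
      then have "x \<in> {x \<in> A. S x = Z}" by (simp only: gSome)
      then have Z: "Z \<subseteq> {..<l}" using S by blast
      have "(\<Sum>x | x \<in> X \<and> g x = j. w x) = (\<Sum>x | x \<in> A \<and> S x = Z. K - card Z)"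
        unfolding Some gSome by (rule sum.cong) (auto simp: w_def A_def)
      then show ?thesis using colA[OF Z] Some by simp
    qed
  qed (use finX q in auto)
  have finY: "finite Y" using YX finX finite_subset by blast
  \<comment> \<open>The rounding speaks of nonempty columns only; for a trace that does not occur,
    \<open>colA\<close> forces \<open>b (Some Z) = 0\<close>.\<close>
  have Ycol': "card {x \<in> Y. g x = Some Z} = b (Some Z)" if Z: "Z \<subseteq> {..<l}" for Z
  proof (cases "Some Z \<in> g ` X")
    case False
    then have no: "g x \<noteq> Some Z" if "x \<in> X" for x using that by (metis imageI)
    then have "{x \<in> X. g x = Some Z} = {}" "{x \<in> Y. g x = Some Z} = {}" using YX by blast+
    then have "card {x \<in> A. S x = Z} = 0" "card {x \<in> Y. g x = Some Z} = 0"
      by (simp_all only: gSome card.empty)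
    then show ?thesis using colA[OF Z] q by simp
  qed (rule Ycol)
  have Yg: "{x \<in> Y. g x = Some Z} = {x \<in> A. x \<in> Y \<and> S x = Z}" for Z
    using YX gSome[of Z] by blast
  have Yle: "i < t \<and> (j < s i \<or> j = s i)" if "(i, j) \<in> Y" for i j
    using subsetD[OF YX that] by (auto simp: X_def)
  define S' where "S' x = (if x \<in> Y then insert l (S x) else S x)" for x
  define \<delta> where "\<delta> i = (if (i, s i) \<in> Y then 1 else 0 :: nat)" for i
  define e' where "e' i = e i - \<delta> i" for i
  have Yrow': "card {j. j < s i \<and> (i, j) \<in> Y} + \<delta> i = D i" if i: "i < t" for i
  proof -
    have "{x \<in> Y. fst x = i} = Pair i ` ({j. j < s i \<and> (i, j) \<in> Y} \<union> (if (i, s i) \<in> Y then {s i} else {}))"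
      using Yle by (force simp: image_iff)
    then have "card {x \<in> Y. fst x = i} = card ({j. j < s i \<and> (i, j) \<in> Y} \<union> (if (i, s i) \<in> Y then {s i} else {}))"
      by (simp add: card_image inj_on_def)
    also have "\<dots> = card {j. j < s i \<and> (i, j) \<in> Y} + \<delta> i" by (auto simp: \<delta>_def)
    moreover have "i \<in> fst ` X" using i by (force simp: X_def)
    ultimately show ?thesis using Yrow[of i] by simp
  qed
  have \<delta>e: "\<delta> i \<le> e i" if "i < t" for i
    using Ypos[of "(i, s i)"] by (auto simp: \<delta>_def w_def)
  have lS: "l \<notin> S x" "finite (S x)" if "x \<in> A" for x
    using S[OF that] finite_subset by auto
  have "baranyai_stage n K t s D m (Suc l) S' e'"
    unfolding baranyai_stage_def A_def[symmetric] q'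
  proof (intro conjI allI impI ballI)
    show "S' x \<subseteq> {..<Suc l}" if "x \<in> A" for x using S[OF that] by (auto simp: S'_def)
    show "card {x \<in> A. S' x = Z'} = (if card Z' \<le> K then (q - 1) choose (K - card Z') else 0)"
      if Z': "Z' \<subseteq> {..<Suc l}" for Z'
    proof (cases "l \<in> Z'")
      case True
      define Z where "Z = Z' - {l}"
      have Z: "Z \<subseteq> {..<l}" using Z' by (auto simp: Z_def less_Suc_eq)
      have "finite Z'" using Z' finite_subset by blast
      then have cZ: "card Z' = Suc (card Z)" using True by (simp only: Z_def card_Suc_Diff1)
      have "S' x = Z' \<longleftrightarrow> x \<in> Y \<and> S x = Z" if "x \<in> A" for x
        using True lS(1)[OF that] unfolding S'_def Z_def by auto
      then have "{x \<in> A. S' x = Z'} = {x \<in> A. x \<in> Y \<and> S x = Z}" by (intro Collect_cong) blast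
      then show ?thesis using Ycol'[OF Z] unfolding Yg by (auto simp: b_def cZ)
    next
      case False
      then have Z: "Z' \<subseteq> {..<l}" using Z' by (auto simp: less_Suc_eq subset_iff)
      have "S' x = Z' \<longleftrightarrow> x \<notin> Y \<and> S x = Z'" for x
        using False unfolding S'_def by auto
      then have "{x \<in> A. S' x = Z'} = {x \<in> A. S x = Z'} - {x \<in> A. x \<in> Y \<and> S x = Z'}" by blast
      moreover have "card ({x \<in> A. S x = Z'} - {x \<in> A. x \<in> Y \<and> S x = Z'}) =
          card {x \<in> A. S x = Z'} - card {x \<in> A. x \<in> Y \<and> S x = Z'}"
        by (rule card_Diff_subset) (use finA in \<open>simp, blast\<close>)
      ultimately have "card {x \<in> A. S' x = Z'} = card {x \<in> A. S x = Z'} - b (Some Z')"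
        using Ycol'[OF Z] by (simp only: Yg)
      \<comment> \<open>Pascal's rule splits the completions of a trace according to whether they
        contain \<open>l\<close>.\<close>
      moreover have "q choose (K - card Z') = ((q - 1) choose (K - card Z')) + ((q - 1) choose (K - card Z' - 1))"
        if "card Z' < K" using that q choose_reduce_nat[of q "K - card Z'"] by simp
      ultimately show ?thesis using cnt[OF Z] by (auto simp: b_def)
    qed
    \<comment> \<open>A dummy of full weight \<open>q\<close> is always selected, so
      \<open>e i\<close> drops whenever it has to.\<close>
    show "e' i \<le> q - 1" if i: "i < t" for i
    proof (cases "e i = q")
      case True
      then have "(i, s i) \<in> Y" using Yfull[of "(i, s i)"] i by (simp add: X_def w_def)
      then show ?thesis using True by (simp add: e'_def \<delta>_def)
    next
      case False then show ?thesis using e[OF i] by (simp add: e'_def)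
    qed
    show "(\<Sum>j<s i. K - card (S' (i, j))) + e' i = D i * (q - 1)" if i: "i < t" for i
    proof -
      have "K - card (S (i, j)) = (K - card (S' (i, j))) + (if (i, j) \<in> Y then 1 else 0)" if j: "j < s i" for j
        using lS[of "(i, j)"] Ypos[of "(i, j)"] i j by (auto simp: A_def S'_def w_def)
      then have "(\<Sum>j<s i. K - card (S (i, j))) = (\<Sum>j<s i. (K - card (S' (i, j))) + (if (i, j) \<in> Y then 1 else 0))"
        by (intro sum.cong) auto
      also have "\<dots> = (\<Sum>j<s i. K - card (S' (i, j))) + card {j. j < s i \<and> (i, j) \<in> Y}"
        by (simp add: sum.distrib sum.If_cases Int_def)
      finally show ?thesis
        using rowsum[OF i] Yrow'[OF i] \<delta>e[OF i] by (simp add: e'_def diff_mult_distrib2)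
    qed
    have "(\<Sum>i<t. e' i) = (\<Sum>i<t. e i) - (\<Sum>i<t. \<delta> i)"
      unfolding e'_def by (rule sum_subtractf_nat) (use \<delta>e in auto)
    moreover have "(\<Sum>i<t. \<delta> i) = m" if "0 < t"
    proof -
      have "None \<in> g ` X" using that by (force simp: g_def X_def image_iff)
      then have "card {x \<in> Y. g x = None} = m" using Ycol by (simp add: b_def)
      moreover have "{x \<in> Y. g x = None} = (\<lambda>i. (i, s i)) ` {i. i < t \<and> (i, s i) \<in> Y}"
        using Yle by (force simp: g_def split: if_splits)
      ultimately have "card {i. i < t \<and> (i, s i) \<in> Y} = m" by (simp add: card_image inj_on_def)
      then show ?thesis by (simp add: \<delta>_def sum.If_cases Int_def)
    qed
    \<comment> \<open>Without classes there is no column \<open>None\<close> to count.\<close>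
    moreover have "m = 0" if "t = 0" using that esum q by simp
    ultimately show "(\<Sum>i<t. e' i) = m * (q - 1)"
      using esum by (cases "t = 0") (simp_all add: diff_mult_distrib2)
    fix i x assume i: "i < t" and x: "x < Suc l"
    have "{j. j < s i \<and> x \<in> S' (i, j)} = (if x = l then {j. j < s i \<and> (i, j) \<in> Y} else {j. j < s i \<and> x \<in> S (i, j)})"
      using i lS(1) by (auto simp: S'_def A_def)
    then have "D i \<le> card {j. j < s i \<and> x \<in> S' (i, j)} + 1 \<and> card {j. j < s i \<and> x \<in> S' (i, j)} \<le> D i"
      using Yrow'[OF i] deg[OF i, of x] x by (auto simp: \<delta>_def split: if_splits)
    then show "D i \<le> card {j. j < s i \<and> x \<in> S' (i, j)} + 1" "card {j. j < s i \<and> x \<in> S' (i, j)} \<le> D i" by auto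
  qed
  then show ?thesis by blast
qed

text \<open>Baranyai's theorem with prescribed class sizes: the hypothesis places the average degree
  of class \<open>i\<close> between \<open>D i - 1\<close> and \<open>D i\<close>, and every degree
  becomes one of the two. The stages run from \<open>l = 0\<close>, where all traces are empty, to
  \<open>l = n\<close>, where the count \<open>0 choose (K - card Z)\<close> makes every
  \<open>K\<close>-set occur exactly once.\<close>

theorem baranyai_lessThan:
  fixes n K t :: nat and s D :: "nat \<Rightarrow> nat"
  assumes sizes: "(\<Sum>i<t. s i) = n choose K" and n: "0 < n" and K: "0 < K"
    and D: "\<forall>i<t. s i * K \<le> D i * n \<and> D i * n \<le> s i * K + n"
  shows "\<exists>\<phi>. (\<forall>Z. Z \<subseteq> {..<n} \<and> card Z = K \<longrightarrow> \<phi> Z < t) \<and>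
    (\<forall>i<t. card {Z. Z \<subseteq> {..<n} \<and> card Z = K \<and> \<phi> Z = i} = s i) \<and>
    (\<forall>i<t. \<forall>x<n. D i \<le> card {Z. Z \<subseteq> {..<n} \<and> card Z = K \<and> \<phi> Z = i \<and> x \<in> Z} + 1 \<and>
       card {Z. Z \<subseteq> {..<n} \<and> card Z = K \<and> \<phi> Z = i \<and> x \<in> Z} \<le> D i)"
proof -
  define e where "e i = D i * n - s i * K" for i
  \<comment> \<open>A point lies in \<open>(n - 1) choose (K - 1)\<close> sets, so \<open>m\<close>
    is the number of classes in which its degree is \<open>D i - 1\<close>.\<close>
  define m where "m = (\<Sum>i<t. D i) - ((n - 1) choose (K - 1))"
  have "(\<Sum>i<t. e i) = (\<Sum>i<t. D i * n) - (\<Sum>i<t. s i * K)"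
    unfolding e_def by (rule sum_subtractf_nat) (use D in auto)
  also have "\<dots> = (\<Sum>i<t. D i) * n - K * (n choose K)" 
    by (simp add: sum_distrib_right[symmetric] sizes mult.commute[of K])
  also have "K * (n choose K) = n * ((n - 1) choose (K - 1))" by (rule times_binomial_minus1_eq[OF K])
  finally have esum: "(\<Sum>i<t. e i) = m * n" by (simp add: m_def diff_mult_distrib2 mult.commute)
  have "\<exists>S e'. baranyai_stage n K t s D m l S e'" if "l \<le> n" for l
    using that
  proof (induction l)
    case 0
    have "e i \<le> n" if "i < t" for i using D that by (auto simp: e_def)
    then have "baranyai_stage n K t s D m 0 (\<lambda>_. {}) e"
      unfolding baranyai_stage_def
      using D esum sizes by (auto simp: e_def)
    then show ?case by blast
  next
    case (Suc l)
    then show ?case using baranyai_stage_Suc by (metis Suc_leD Suc_le_lessD)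
  qed
  from this[of n] obtain S e' where stage: "baranyai_stage n K t s D m n S e'" by blast
  define A where "A = Sigma {..<t} (\<lambda>i. {..<s i})"
  have S: "\<And>x. x \<in> A \<Longrightarrow> S x \<subseteq> {..<n}"
    and cnt: "\<And>Z. Z \<subseteq> {..<n} \<Longrightarrow> card {x \<in> A. S x = Z} = (if card Z \<le> K then 0 choose (K - card Z) else 0)"
    and deg: "\<And>i x. i < t \<Longrightarrow> x < n \<Longrightarrow> D i \<le> card {j. j < s i \<and> x \<in> S (i, j)} + 1 \<and> card {j. j < s i \<and> x \<in> S (i, j)} \<le> D i"
    using stage[unfolded baranyai_stage_def diff_self_eq_0, folded A_def] by blast+
  define V where "V = {Z. Z \<subseteq> {..<n} \<and> card Z = K}"
  have finA: "finite A" by (simp add: A_def)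
  have "S x \<in> V" if x: "x \<in> A" for x
  proof -
    have "card {x} \<le> card {y \<in> A. S y = S x}" by (rule card_mono) (use x finA in auto)
    then have "card {y \<in> A. S y = S x} \<noteq> 0" by simp
    then have "(if card (S x) \<le> K then 0 choose (K - card (S x)) else 0) \<noteq> 0" using cnt[OF S[OF x]] by simp
    then have "card (S x) = K" by (cases "K - card (S x)") (auto split: if_splits)
    then show ?thesis using S[OF x] by (simp add: V_def)
  qed
  then have SV: "S ` A \<subseteq> V" by blast
  have one: "card {x \<in> A. S x = Z} = 1" if "Z \<in> V" for Z
    using cnt[of Z] that by (simp add: V_def)
  have inj: "inj_on S A"
  proof (rule inj_onI)
    fix x y assume xy: "x \<in> A" "y \<in> A" "S x = S y"
    have "card {z \<in> A. S z = S x} = 1" using one SV xy by blast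
    then obtain u where "{z \<in> A. S z = S x} = {u}" by (auto simp: card_1_singleton_iff)
    then show "x = y" using xy by (metis (mono_tags, lifting) mem_Collect_eq singletonD)
  qed
  have img: "S ` A = V"
  proof
    show "V \<subseteq> S ` A"
    proof
      fix Z assume "Z \<in> V"
      then have "{x \<in> A. S x = Z} \<noteq> {}" using one by (metis card.empty zero_neq_one)
      then show "Z \<in> S ` A" by blast
    qed
  qed (rule SV)
  define \<phi> where "\<phi> Z = fst (the_inv_into A S Z)" for Z
  have \<phi>S: "\<phi> (S x) = fst x" if "x \<in> A" for x using that inj by (simp add: \<phi>_def the_inv_into_f_f)
  have cls: "{Z. Z \<subseteq> {..<n} \<and> card Z = K \<and> \<phi> Z = i \<and> P Z} = (\<lambda>j. S (i, j)) ` {j. j < s i \<and> P (S (i, j))}"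
    if i: "i < t" for i P
  proof -
    have "{Z. Z \<subseteq> {..<n} \<and> card Z = K \<and> \<phi> Z = i \<and> P Z} = {Z \<in> S ` A. \<phi> Z = i \<and> P Z}"
      unfolding img by (auto simp: V_def)
    also have "\<dots> = S ` {x \<in> A. fst x = i \<and> P (S x)}" using \<phi>S by auto
    also have "{x \<in> A. fst x = i \<and> P (S x)} = Pair i ` {j. j < s i \<and> P (S (i, j))}"
      using i by (auto simp: A_def)
    finally show ?thesis by (simp add: image_image)
  qed
  have inji: "inj_on (\<lambda>j. S (i, j)) {j. j < s i \<and> P (S (i, j))}" if "i < t" for i P
    using that inj by (auto simp: inj_on_def A_def)
  show ?thesis
  proof (intro exI[of _ \<phi>] conjI allI impI)
    show "\<phi> Z < t" if "Z \<subseteq> {..<n} \<and> card Z = K" for Z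
    proof -
      have "Z \<in> S ` A" unfolding img using that by (simp add: V_def)
      then show ?thesis using \<phi>S by (auto simp: A_def)
    qed
    fix i assume i: "i < t"
    show "card {Z. Z \<subseteq> {..<n} \<and> card Z = K \<and> \<phi> Z = i} = s i"
      using cls[OF i, of "\<lambda>_. True"] inji[OF i, of "\<lambda>_. True"] by (simp add: card_image)
    fix x assume x: "x < n"
    have c: "card {Z. Z \<subseteq> {..<n} \<and> card Z = K \<and> \<phi> Z = i \<and> x \<in> Z} = card {j. j < s i \<and> x \<in> S (i, j)}"
      using cls[OF i, of "\<lambda>Z. x \<in> Z"] inji[OF i, of "\<lambda>Z. x \<in> Z"] by (simp add: card_image)
    show "D i \<le> card {Z. Z \<subseteq> {..<n} \<and> card Z = K \<and> \<phi> Z = i \<and> x \<in> Z} + 1"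
      "card {Z. Z \<subseteq> {..<n} \<and> card Z = K \<and> \<phi> Z = i \<and> x \<in> Z} \<le> D i"
      unfolding c using deg[OF i x] by auto
  qed
qed

theorem baranyai:
  fixes A :: "'a set" and K t :: nat and s D :: "nat \<Rightarrow> nat"
  assumes A: "finite A" "A \<noteq> {}" and K: "0 < K" and sizes: "(\<Sum>i<t. s i) = card A choose K"
    and D: "\<forall>i<t. s i * K \<le> D i * card A \<and> D i * card A \<le> s i * K + card A"
  shows "\<exists>\<phi>. (\<forall>Z. Z \<subseteq> A \<and> card Z = K \<longrightarrow> \<phi> Z < t) \<and>
    (\<forall>i<t. card {Z. Z \<subseteq> A \<and> card Z = K \<and> \<phi> Z = i} = s i) \<and>
    (\<forall>i<t. \<forall>x\<in>A. D i \<le> card {Z. Z \<subseteq> A \<and> card Z = K \<and> \<phi> Z = i \<and> x \<in> Z} + 1 \<and>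
       card {Z. Z \<subseteq> A \<and> card Z = K \<and> \<phi> Z = i \<and> x \<in> Z} \<le> D i)"
proof -
  define n where "n = card A"
  have n: "0 < n" using A by (simp add: n_def card_gt_0_iff)
  obtain g where "bij_betw g A {0..<n}" using ex_bij_betw_finite_nat[OF A(1)] by (auto simp: n_def)
  then have inj: "inj_on g A" and img: "g ` A = {..<n}" by (auto simp: bij_betw_def lessThan_atLeast0)
  obtain \<phi> where "\<forall>Z. Z \<subseteq> {..<n} \<and> card Z = K \<longrightarrow> \<phi> Z < t"
    "\<forall>i<t. card {Z. Z \<subseteq> {..<n} \<and> card Z = K \<and> \<phi> Z = i} = s i"
    "\<forall>i<t. \<forall>x<n. D i \<le> card {Z. Z \<subseteq> {..<n} \<and> card Z = K \<and> \<phi> Z = i \<and> x \<in> Z} + 1 \<and>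
       card {Z. Z \<subseteq> {..<n} \<and> card Z = K \<and> \<phi> Z = i \<and> x \<in> Z} \<le> D i"
    using baranyai_lessThan[OF sizes[folded n_def] n K D[folded n_def]] by (elim exE conjE) (rule that)
  note \<phi> = this[rule_format]
  have cardg: "card (g ` Z) = card Z" if "Z \<subseteq> A" for Z
    using that inj by (meson card_image inj_on_subset)
  have transfer: "card {Z. Z \<subseteq> A \<and> card Z = K \<and> P (g ` Z)} = card {Z. Z \<subseteq> {..<n} \<and> card Z = K \<and> P Z}" for P
  proof (rule bij_betw_same_card[of "image g"])
    have "inj_on (image g) (Pow A)" using inj by (rule inj_on_image_Pow)
    then have "inj_on (image g) {Z. Z \<subseteq> A \<and> card Z = K \<and> P (g ` Z)}"
      by (rule inj_on_subset) auto
    moreover have "image g ` {Z. Z \<subseteq> A \<and> card Z = K \<and> P (g ` Z)} = {Z. Z \<subseteq> {..<n} \<and> card Z = K \<and> P Z}"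
    proof
      show "{Z. Z \<subseteq> {..<n} \<and> card Z = K \<and> P Z} \<subseteq> image g ` {Z. Z \<subseteq> A \<and> card Z = K \<and> P (g ` Z)}"
      proof
        fix Z assume Z: "Z \<in> {Z. Z \<subseteq> {..<n} \<and> card Z = K \<and> P Z}"
        then have "Z \<subseteq> g ` A" by (simp add: img)
        then obtain W where "W \<subseteq> A" "Z = g ` W" by (auto simp: subset_image_iff)
        then show "Z \<in> image g ` {Z. Z \<subseteq> A \<and> card Z = K \<and> P (g ` Z)}" using Z cardg by auto
      qed
      show "image g ` {Z. Z \<subseteq> A \<and> card Z = K \<and> P (g ` Z)} \<subseteq> {Z. Z \<subseteq> {..<n} \<and> card Z = K \<and> P Z}"
        using cardg by (auto simp flip: img)
    qed
    ultimately show "bij_betw (image g) {Z. Z \<subseteq> A \<and> card Z = K \<and> P (g ` Z)} {Z. Z \<subseteq> {..<n} \<and> card Z = K \<and> P Z}"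
      by (simp add: bij_betw_def)
  qed
  show ?thesis
  proof (intro exI[of _ "\<lambda>Z. \<phi> (g ` Z)"] conjI allI impI ballI)
    show "\<phi> (g ` Z) < t" if "Z \<subseteq> A \<and> card Z = K" for Z
      using that img cardg by (intro \<phi>(1)) blast
    fix i assume i: "i < t"
    show "card {Z. Z \<subseteq> A \<and> card Z = K \<and> \<phi> (g ` Z) = i} = s i"
      using \<phi>(2)[OF i] transfer[of "\<lambda>Z. \<phi> Z = i"] by simp
    fix x assume x: "x \<in> A"
    have "{Z. Z \<subseteq> A \<and> card Z = K \<and> \<phi> (g ` Z) = i \<and> x \<in> Z} = {Z. Z \<subseteq> A \<and> card Z = K \<and> \<phi> (g ` Z) = i \<and> g x \<in> g ` Z}"
      using inj_on_image_mem_iff[OF inj x] by blast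
    then have c: "card {Z. Z \<subseteq> A \<and> card Z = K \<and> \<phi> (g ` Z) = i \<and> x \<in> Z} =
        card {Z. Z \<subseteq> {..<n} \<and> card Z = K \<and> \<phi> Z = i \<and> g x \<in> Z}"
      using transfer[of "\<lambda>Z. \<phi> Z = i \<and> g x \<in> Z"] by simp
    have "g x < n" using x img by blast
    then show "D i \<le> card {Z. Z \<subseteq> A \<and> card Z = K \<and> \<phi> (g ` Z) = i \<and> x \<in> Z} + 1"
      "card {Z. Z \<subseteq> A \<and> card Z = K \<and> \<phi> (g ` Z) = i \<and> x \<in> Z} \<le> D i"
      unfolding c using \<phi>(3)[OF i] by auto
  qed
qed

text \<open>Blocks of size \<open>p\<close> are filled one after the other until \<open>c\<close> is
  used up.\<close>

lemma sum_min_diff_mult: "(\<Sum>i<t. min p (c - i * p)) = min c (t * p)" for c p :: nat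
  by (induction t) (auto simp: min_def)

text \<open>All classes have size \<open>p\<close> until the sets run out. If
  \<open>p * K \<le> card A\<close>, degrees are at most 1 and classes consist of disjoint sets;
  otherwise degrees in a full class are at least 1 and it covers \<open>A\<close>. The truncated
  difference in the last claim states both at once.\<close>

corollary baranyai_uniform:
  fixes A :: "'a set" and K p t :: nat
  assumes A: "finite A" "A \<noteq> {}" and K: "0 < K" and p: "0 < p" and t: "card A choose K \<le> t * p"
  obtains \<phi> where "\<And>Z. Z \<subseteq> A \<Longrightarrow> card Z = K \<Longrightarrow> \<phi> Z < t"
    "\<And>i. Suc i * p \<le> card A choose K \<Longrightarrow> card {Z. Z \<subseteq> A \<and> card Z = K \<and> \<phi> Z = i} = p"
    "\<And>Y Z. p * K \<le> card A \<Longrightarrow> Y \<subseteq> A \<Longrightarrow> card Y = K \<Longrightarrow> Z \<subseteq> A \<Longrightarrow> card Z = K \<Longrightarrow> \<phi> Y = \<phi> Z \<Longrightarrow> Y \<noteq> Z \<Longrightarrow> Y \<inter> Z = {}"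
    "\<And>i. Suc i * p \<le> card A choose K \<Longrightarrow> card (A - \<Union>{Z. Z \<subseteq> A \<and> card Z = K \<and> \<phi> Z = i}) \<le> card A - p * K"
proof -
  define n where "n = card A"
  have n: "0 < n" using A by (simp add: n_def card_gt_0_iff)
  define s where "s i = min p ((n choose K) - i * p)" for i
  \<comment> \<open>The average degree \<open>s i * K / n\<close>, rounded up.\<close>
  define D where "D i = (s i * K + (n - 1)) div n" for i
  have sum: "(\<Sum>i<t. s i) = card A choose K"
    using t by (simp add: s_def sum_min_diff_mult n_def)
  have deg: "s i * K \<le> D i * card A \<and> D i * card A \<le> s i * K + card A" for i
  proof -
    have "D i * n + (s i * K + (n - 1)) mod n = s i * K + (n - 1)" unfolding D_def by simp
    moreover have "(s i * K + (n - 1)) mod n < n" using n by simp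
    ultimately show ?thesis unfolding n_def[symmetric] by linarith
  qed
  obtain \<phi> where "\<forall>Z. Z \<subseteq> A \<and> card Z = K \<longrightarrow> \<phi> Z < t"
    "\<forall>i<t. card {Z. Z \<subseteq> A \<and> card Z = K \<and> \<phi> Z = i} = s i"
    "\<forall>i<t. \<forall>x\<in>A. D i \<le> card {Z. Z \<subseteq> A \<and> card Z = K \<and> \<phi> Z = i \<and> x \<in> Z} + 1 \<and>
       card {Z. Z \<subseteq> A \<and> card Z = K \<and> \<phi> Z = i \<and> x \<in> Z} \<le> D i"
    using baranyai[OF A K sum, OF allI[OF impI[OF deg]]] by (elim exE conjE) (rule that)
  note \<phi> = this[rule_format]
  have full: "i < t" "s i = p" if "Suc i * p \<le> card A choose K" for i
  proof -
    have "Suc i * p \<le> t * p" using that t by linarith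
    then show "i < t" using p by (simp only: mult_le_cancel2) simp
    show "s i = p" using that by (simp add: s_def n_def)
  qed
  have disj: "Y \<inter> Z = {}"
    if pK: "p * K \<le> card A" and Y: "Y \<subseteq> A" "card Y = K" and Z: "Z \<subseteq> A" "card Z = K" and same: "\<phi> Y = \<phi> Z" and ne: "Y \<noteq> Z" for Y Z
  proof (rule ccontr)
    assume "Y \<inter> Z \<noteq> {}"
    then obtain x where x: "x \<in> Y" "x \<in> Z" by blast
    define i where "i = \<phi> Z"
    have "s i * K \<le> n" using pK by (metis le_trans min.cobounded1 mult_le_mono1 n_def s_def)
    then have "D i < 2" unfolding D_def using n by (simp add: less_mult_imp_div_less)
    moreover have "card {Y, Z} \<le> card {W. W \<subseteq> A \<and> card W = K \<and> \<phi> W = i \<and> x \<in> W}"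
      by (rule card_mono) (use A(1) Y Z x same in \<open>auto simp: i_def\<close>)
    moreover have "card {W. W \<subseteq> A \<and> card W = K \<and> \<phi> W = i \<and> x \<in> W} \<le> D i"
      using \<phi>(3)[of i x] \<phi>(1)[OF conjI[OF Z]] x Z by (auto simp: i_def)
    ultimately show False using ne by simp
  qed
  show thesis
  proof (rule that[of \<phi>])
    fix i assume i: "Suc i * p \<le> card A choose K"
    note full = full[OF i]
    define C where "C = {Z. Z \<subseteq> A \<and> card Z = K \<and> \<phi> Z = i}"
    have finC: "finite C" using A(1) by (simp add: C_def)
    have card: "card C = p" using \<phi>(2)[of i] full by (simp add: C_def)
    then show "card {Z. Z \<subseteq> A \<and> card Z = K \<and> \<phi> Z = i} = p" by (simp add: C_def)
    show "card (A - \<Union>{Z. Z \<subseteq> A \<and> card Z = K \<and> \<phi> Z = i}) \<le> card A - p * K"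
    proof (cases "p * K \<le> card A")
      case True
      have "card (\<Union>C) = (\<Sum>Z\<in>C. card Z)"
        by (rule card_Union_disjoint) (use disj[OF True] A(1) in \<open>auto simp: C_def pairwise_def disjnt_def intro: finite_subset\<close>)
      also have "\<dots> = p * K" using card by (simp add: C_def)
      finally have "card (A - \<Union>C) = card A - p * K"
        using A(1) by (subst card_Diff_subset) (auto simp: C_def intro: finite_subset)
      then show ?thesis by (simp add: C_def)
    next
      case False
      \<comment> \<open>The average degree exceeds 1, so its ceiling is at least 2 and every degree
        at least 1.\<close>
      have "2 * n \<le> s i * K + (n - 1)" using False full n by (simp add: n_def)
      then have "2 \<le> D i" unfolding D_def using n by (simp add: less_eq_div_iff_mult_less_eq)
      then have "\<exists>Z\<in>C. x \<in> Z" if "x \<in> A" for x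
      proof -
        have "1 \<le> card {Z. Z \<subseteq> A \<and> card Z = K \<and> \<phi> Z = i \<and> x \<in> Z}"
          using \<phi>(3)[OF full(1) that] \<open>2 \<le> D i\<close> by linarith
        then have "{Z. Z \<subseteq> A \<and> card Z = K \<and> \<phi> Z = i \<and> x \<in> Z} \<noteq> {}" by force
        then show ?thesis by (auto simp: C_def)
      qed
      then have "A - \<Union>C = {}" by blast
      then have "card (A - \<Union>C) = 0" by (simp only: card.empty)
      then show ?thesis by (simp add: C_def)
    qed
  qed (use \<phi>(1) disj in auto)
qed

section \<open>Minors built from a clique and stars\<close>

lemma switch_equiv_switch_set:
  assumes "finite C" "C \<subseteq> V"
  shows "switch_equiv V (\<lambda>_ _. False) (\<lambda>u v. (u \<in> C) \<noteq> (v \<in> C))"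
  using assms
proof (induction C rule: finite_induct)
  case empty
  then show ?case using se_refl[of V "\<lambda>_ _. False"] by simp
next
  case (insert x C)
  have "switch_equiv V (\<lambda>_ _. False) (switch_at x (\<lambda>u v. (u \<in> C) \<noteq> (v \<in> C)))"
    using insert by (intro se_step) auto
  moreover have "switch_at x (\<lambda>u v. (u \<in> C) \<noteq> (v \<in> C)) = (\<lambda>u v. (u \<in> insert x C) \<noteq> (v \<in> insert x C))"
    using insert(2) by (auto simp: switch_at_def fun_eq_iff)
  ultimately show ?case by simp
qed

text \<open>\<open>GREATEST\<close> is meaningful only for a bounded predicate; picking one vertex
  from each bag bounds the order of the minor by \<open>card V\<close>.\<close>

lemma signed_minor_le_odd_hadwiger:
  assumes "finite V" "signed_minor {..<t} (\<lambda>x y. x \<noteq> y) (\<lambda>_ _. False) V E (\<lambda>_ _. False)"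
  shows "t \<le> odd_hadwiger V E"
  unfolding odd_hadwiger_def
proof (rule Greatest_le_nat[where b = "card V"])
  fix m :: nat
  assume "signed_minor {..<m} (\<lambda>x y. x \<noteq> y) (\<lambda>_ _. False) V E (\<lambda>_ _. False)"
  then obtain \<tau> W F where sub: "\<forall>x\<in>{..<m}. subgraph (W x) (F x) V E"
    and disj: "\<forall>x\<in>{..<m}. \<forall>y\<in>{..<m}. x \<noteq> y \<longrightarrow> W x \<inter> W y = {}"
    and conn: "\<forall>x\<in>{..<m}. connected_graph (W x) (\<lambda>u v. F x u v \<and> \<tau> u v)"
    unfolding signed_minor_def by (elim exE conjE) (rule that)
  have "\<forall>x\<in>{..<m}. \<exists>v. v \<in> W x" using conn by (auto simp: connected_graph_def)
  then obtain v where v: "\<forall>x\<in>{..<m}. v x \<in> W x" by (rule bchoice[THEN exE])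
  have "inj_on v {..<m}" 
  proof (rule inj_onI, rule ccontr)
    fix x y assume xy: "x \<in> {..<m}" "y \<in> {..<m}" "v x = v y" "x \<noteq> y"
    then have "W x \<inter> W y = {}" using disj by blast
    moreover have "v x \<in> W x" "v x \<in> W y" using v xy by metis+
    ultimately show False by blast
  qed
  moreover have "v ` {..<m} \<subseteq> V" using v sub by (auto simp: subgraph_def)
  ultimately show "m \<le> card V" using card_inj_on_le[of v "{..<m}" V] assms(1) by simp
qed (rule assms(2))

definition star_edges :: "'a \<Rightarrow> 'a set \<Rightarrow> 'a \<Rightarrow> 'a \<Rightarrow> bool" where
  "star_edges c L u v \<longleftrightarrow> (u = c \<and> v \<in> L) \<or> (v = c \<and> u \<in> L)"

text \<open>With \<open>L\<close> empty this also serves the single-vertex bags.\<close>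

lemma connected_graph_star:
  assumes "\<And>u. u \<in> L \<Longrightarrow> R c u \<and> R u c"
  shows "connected_graph (insert c L) R"
proof -
  let ?R = "\<lambda>a b. a \<in> insert c L \<and> b \<in> insert c L \<and> R a b"
  have "?R\<^sup>*\<^sup>* u c \<and> ?R\<^sup>*\<^sup>* c u" if "u \<in> insert c L" for u
    using that assms by (cases "u = c") auto
  then show ?thesis unfolding connected_graph_def by (meson insert_not_empty rtranclp_trans)
qed

text \<open>Switching all star centres makes the bags positive and leaves the connecting edges, which
  join leaves and single vertices, negative.\<close>

lemma clique_stars_minor:
  fixes V Q :: "'a set" and I :: "'i set"
  assumes finV: "finite V" and sym: "\<And>u v. E u v \<Longrightarrow> E v u"
    and QV: "Q \<subseteq> V" and clique: "\<And>u v. u \<in> Q \<Longrightarrow> v \<in> Q \<Longrightarrow> u \<noteq> v \<Longrightarrow> E u v"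
    and finI: "finite I"
    and L: "\<And>i. i \<in> I \<Longrightarrow> L i \<subseteq> V - Q" "\<And>i. i \<in> I \<Longrightarrow> L i \<noteq> {}"
    and c: "\<And>i. i \<in> I \<Longrightarrow> c i \<in> V - Q" "\<And>i. i \<in> I \<Longrightarrow> c i \<notin> L i"
    and adj: "\<And>i u. i \<in> I \<Longrightarrow> u \<in> L i \<Longrightarrow> E (c i) u"
    and disj: "\<And>i j. i \<in> I \<Longrightarrow> j \<in> I \<Longrightarrow> i \<noteq> j \<Longrightarrow> insert (c i) (L i) \<inter> insert (c j) (L j) = {}"
    and touchQ: "\<And>i u. i \<in> I \<Longrightarrow> u \<in> Q \<Longrightarrow> \<exists>v\<in>L i. E u v"
    and touch: "\<And>i j. i \<in> I \<Longrightarrow> j \<in> I \<Longrightarrow> i \<noteq> j \<Longrightarrow> \<exists>u\<in>L i. \<exists>v\<in>L j. E u v"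
  shows "strongly_1_shallow_Kt_minor V E (card Q + card I)"
    and "card Q + card I \<le> odd_hadwiger V E"
proof -
  define t where "t = card Q + card I"
  have finQ: "finite Q" using QV finV finite_subset by blast
  define J where "J = Inl ` Q \<union> (Inr ` I :: ('a + 'i) set)"
  have "card J = t" unfolding J_def t_def using finQ finI
    by (subst card_Un_disjoint) (auto simp: card_image)
  moreover have "finite J" using finQ finI by (simp add: J_def)
  ultimately obtain h where "bij_betw h {0..<t} J" using ex_bij_betw_nat_finite by metis
  then have hJ: "h x \<in> J" and hinj: "y < t \<Longrightarrow> x \<noteq> y \<Longrightarrow> h x \<noteq> h y" if "x < t" for x y
    using that by (auto simp: bij_betw_def inj_on_def)
  define B where "B z = (case z of Inl u \<Rightarrow> {u} | Inr i \<Rightarrow> insert (c i) (L i))" for z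
  define G where "G z = (case z of Inl u \<Rightarrow> (\<lambda>_ _. False) | Inr i \<Rightarrow> star_edges (c i) (L i))" for z :: "'a + 'i"
  \<comment> \<open>The vertices of a bag at which connecting edges may end: the single vertex, or
    the leaves.\<close>
  define M where "M z = (case z of Inl u \<Rightarrow> {u} | Inr i \<Rightarrow> L i)" for z
  have sub: "subgraph (B z) (G z) V E" if "z \<in> J" for z
  proof (cases z)
    case (Inl u) then show ?thesis using that QV by (auto simp: J_def B_def G_def subgraph_def)
  next
    case (Inr i)
    then have i: "i \<in> I" using that by (auto simp: J_def)
    show ?thesis unfolding Inr B_def G_def sum.case subgraph_def star_edges_def
      using L(1)[OF i] c(1)[OF i] adj[OF i] sym[OF adj[OF i]] by blast
  qed
  \<comment> \<open>A case rule for two distinct bags; disjointness and joining are both proved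
    through it.\<close>
  have J_pairs: "P y z" if "y \<in> J" "z \<in> J" "y \<noteq> z"
    and "\<And>u v. u \<in> Q \<Longrightarrow> v \<in> Q \<Longrightarrow> u \<noteq> v \<Longrightarrow> P (Inl u) (Inl v)"
    and "\<And>u i. u \<in> Q \<Longrightarrow> i \<in> I \<Longrightarrow> P (Inl u) (Inr i)"
    and "\<And>u i. u \<in> Q \<Longrightarrow> i \<in> I \<Longrightarrow> P (Inr i) (Inl u)"
    and "\<And>i j. i \<in> I \<Longrightarrow> j \<in> I \<Longrightarrow> i \<noteq> j \<Longrightarrow> P (Inr i) (Inr j)" for P y z
    using that(1,2) unfolding J_def by (elim UnE imageE) (use that(3-) in simp_all)
  have QL: "u \<notin> insert (c i) (L i)" if "u \<in> Q" "i \<in> I" for u i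
    using that L(1)[of i] c(1)[of i] by blast
  have dis: "B y \<inter> B z = {}" if "y \<in> J" "z \<in> J" "y \<noteq> z" for y z
    by (rule J_pairs[OF that]) (use QL disj in \<open>simp_all add: B_def\<close>)
  have MB: "M z \<subseteq> B z" if "z \<in> J" for z using that by (auto simp: J_def M_def B_def)
  have join: "\<exists>u\<in>M y. \<exists>v\<in>M z. E u v" if "y \<in> J" "z \<in> J" "y \<noteq> z" for y z
  proof (rule J_pairs[OF that])
    show "\<exists>u\<in>M (Inr i). \<exists>v\<in>M (Inl w). E u v" if "w \<in> Q" "i \<in> I" for w i
      using touchQ[OF that(2,1)] sym by (auto simp: M_def)
  qed (use clique touch touchQ in \<open>simp_all add: M_def\<close>)
  have finL: "finite (L i)" if "i \<in> I" for i using L(1)[OF that] finV finite_subset by blast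
  have star: "star_bag (insert (c i) (L i)) (star_edges (c i) (L i))" if i: "i \<in> I" for i
  proof -
    have "0 < card (L i)" using L(2)[OF i] finL[OF i] by (simp add: card_gt_0_iff)
    then have "card (insert (c i) (L i)) \<ge> 2" using c(2)[OF i] finL[OF i] by simp
    then show ?thesis using finL[OF i] c(2)[OF i] unfolding star_bag_def star_edges_def by auto
  qed
  have good: "good_end (B z) (G z) u" if z: "z \<in> J" and u: "u \<in> M z" for z u
  proof (cases z)
    case (Inl v)
    then show ?thesis using u by (simp add: good_end_def B_def M_def)
  next
    case (Inr i)
    then have i: "i \<in> I" and u: "u \<in> L i" using z u by (auto simp: J_def M_def)
    \<comment> \<open>\<open>good_end\<close> recognises a leaf by its degree 1 within the
      star.\<close>
    have "{w \<in> insert (c i) (L i). star_edges (c i) (L i) u w} = {c i}"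
      using u c(2)[OF i] by (auto simp: star_edges_def)
    then show ?thesis using star[OF i] u by (simp add: good_end_def B_def G_def Inr)
  qed
  have conn: "connected_graph (B z) (G z)" if "z \<in> J" for z
  proof (cases z)
    case (Inl v)
    then show ?thesis using connected_graph_star[of "{}"] by (simp add: B_def)
  next
    case (Inr i)
    show ?thesis unfolding Inr B_def G_def sum.case
      by (rule connected_graph_star) (simp add: star_edges_def)
  qed
  have shape: "(\<exists>v. B z = {v}) \<or> star_bag (B z) (G z)" if "z \<in> J" for z
    using that star by (auto simp: J_def B_def G_def)
  show "strongly_1_shallow_Kt_minor V E (card Q + card I)"
    unfolding strongly_1_shallow_Kt_minor_def t_def[symmetric]
  proof (intro exI[of _ "\<lambda>x. B (h x)"] exI[of _ "\<lambda>x. G (h x)"] conjI allI impI)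
    fix x y assume x: "x < t" and y: "y < t" and xy: "x \<noteq> y"
    obtain u v where uv: "u \<in> M (h x)" "v \<in> M (h y)" "E u v"
      using join[OF hJ[OF x] hJ[OF y] hinj[OF x y xy]] by blast
    then show "\<exists>u\<in>B (h x). \<exists>v\<in>B (h y). E u v \<and> good_end (B (h x)) (G (h x)) u \<and> good_end (B (h y)) (G (h y)) v"
      using good[OF hJ[OF x] uv(1)] good[OF hJ[OF y] uv(2)] MB[OF hJ[OF x]] MB[OF hJ[OF y]] by blast
    show "B (h x) \<inter> B (h y) = {}" by (rule dis[OF hJ[OF x] hJ[OF y] hinj[OF x y xy]])
  qed (rule sub[OF hJ] conn[OF hJ] shape[OF hJ], assumption)+
  define C where "C = c ` I"
  define \<tau> where "\<tau> = (\<lambda>u v. (u \<in> C) \<noteq> (v \<in> C))"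
  \<comment> \<open>Disjointness of the bags ensures that no leaf is the centre of another star, so
    a bag edge is switched at exactly one end.\<close>
  have LC: "u \<notin> C" if "i \<in> I" "u \<in> L i" for i u
    using that c(2) disj unfolding C_def by blast
  have MC: "u \<notin> C" if "z \<in> J" "u \<in> M z" for z u
  proof (cases z)
    case (Inl v) then show ?thesis using that c(1) by (auto simp: J_def M_def C_def)
  next
    case (Inr i) then show ?thesis using that LC[of i u] by (auto simp: J_def M_def)
  qed
  have posconn: "connected_graph (B z) (\<lambda>u v. G z u v \<and> \<tau> u v)" if "z \<in> J" for z
  proof (cases z)
    case (Inl v)
    then show ?thesis using connected_graph_star[of "{}"] by (simp add: B_def)
  next
    case (Inr i)
    then have i: "i \<in> I" using that by (auto simp: J_def)
    then show ?thesis unfolding Inr B_def G_def sum.case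
      by (intro connected_graph_star) (use LC in \<open>auto simp: \<tau>_def C_def star_edges_def\<close>)
  qed
  have "signed_minor {..<t} (\<lambda>x y. x \<noteq> y) (\<lambda>_ _. False) V E (\<lambda>_ _. False)"
    unfolding signed_minor_def
  proof (intro exI[of _ \<tau>] exI[of _ "\<lambda>x. B (h x)"] exI[of _ "\<lambda>x. G (h x)"] conjI ballI impI)
    show "switch_equiv V (\<lambda>_ _. False) \<tau>"
      unfolding \<tau>_def by (rule switch_equiv_switch_set) (use finI c(1) in \<open>auto simp: C_def\<close>)
    fix x y assume "x \<in> {..<t}" "y \<in> {..<t}" and xy: "x \<noteq> y"
    then have x: "x < t" and y: "y < t" by auto
    obtain u v where uv: "u \<in> M (h x)" "v \<in> M (h y)" "E u v"
      using join[OF hJ[OF x] hJ[OF y] hinj[OF x y xy]] by blast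
    moreover have "\<not> \<tau> u v" using MC[OF hJ[OF x] uv(1)] MC[OF hJ[OF y] uv(2)] by (simp add: \<tau>_def)
    ultimately show "\<exists>u\<in>B (h x). \<exists>v\<in>B (h y). E u v \<and> \<tau> u v = False"
      using MB[OF hJ[OF x]] MB[OF hJ[OF y]] by blast
    show "B (h x) \<inter> B (h y) = {}" by (rule dis[OF hJ[OF x] hJ[OF y] hinj[OF x y xy]])
  qed (use sub posconn hJ in auto)
  then show "card Q + card I \<le> odd_hadwiger V E"
    using signed_minor_le_odd_hadwiger[OF finV] by (simp add: t_def)
qed

section \<open>Star bags in the complement of a Kneser graph\<close>

text \<open>The sets containing \<open>1\<close> form the clique. Without \<open>1\<close> such a
  set has \<open>k - 1\<close> points, too many to fit into the at most \<open>k - 2\<close> points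
  missed by a star. Two stars together miss at most \<open>2 * (k - 2)\<close> points, fewer than
  the \<open>n - 1\<close> available, so some point is covered by both.\<close>

lemma Kbar_star_bags:
  fixes n k :: nat and I :: "'i set"
  assumes k: "2 \<le> k" and n: "2 * k \<le> n" and finI: "finite I"
    and L: "\<And>i S. i \<in> I \<Longrightarrow> S \<in> L i \<Longrightarrow> S \<subseteq> {2..n} \<and> card S = k"
    and c: "\<And>i. i \<in> I \<Longrightarrow> c i \<subseteq> {2..n} \<and> card (c i) = k" "\<And>i. i \<in> I \<Longrightarrow> c i \<notin> L i"
    and adj: "\<And>i S. i \<in> I \<Longrightarrow> S \<in> L i \<Longrightarrow> c i \<inter> S \<noteq> {}"
    and disj: "\<And>i j. i \<in> I \<Longrightarrow> j \<in> I \<Longrightarrow> i \<noteq> j \<Longrightarrow> insert (c i) (L i) \<inter> insert (c j) (L j) = {}"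
    and cover: "\<And>i. i \<in> I \<Longrightarrow> card ({2..n} - \<Union>(L i)) \<le> k - 2"
  shows "strongly_1_shallow_Kt_minor (Kbar_V n k) Kbar_E (((n - 1) choose (k - 1)) + card I)"
    and "((n - 1) choose (k - 1)) + card I \<le> odd_hadwiger (Kbar_V n k) Kbar_E"
proof -
  define Q where "Q = insert 1 ` {Y. Y \<subseteq> {2..n} \<and> card Y = k - 1}"
  have "card Q = card {Y. Y \<subseteq> {2..n} \<and> card Y = k - 1}"
    unfolding Q_def
  proof (rule card_image, rule inj_onI)
    fix Y Z assume "Y \<in> {Y. Y \<subseteq> {2..n} \<and> card Y = k - 1}" "Z \<in> {Y. Y \<subseteq> {2..n} \<and> card Y = k - 1}" and eq: "insert 1 Y = insert 1 Z"
    then have "1 \<notin> Y" "1 \<notin> Z" by auto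
    then show "Y = Z" using eq by (metis insert_ident)
  qed
  then have cardQ: "card Q = (n - 1) choose (k - 1)" by (simp add: n_subsets)
  have V: "S \<in> Kbar_V n k" if "S \<subseteq> {2..n} \<and> card S = k" for S
    using that by (auto simp: Kbar_V_def subset_iff)
  have notQ: "S \<notin> Q" if "S \<subseteq> {2..n} \<and> card S = k" for S
    using that by (auto simp: Q_def)
  have fin: "finite (Kbar_V n k)" unfolding Kbar_V_def by simp
  have QV: "Q \<subseteq> Kbar_V n k"
  proof
    fix S assume "S \<in> Q"
    then obtain Y where Y: "S = insert 1 Y" "Y \<subseteq> {2..n}" "card Y = k - 1" by (auto simp: Q_def)
    then have "finite Y" "1 \<notin> Y" by (auto intro: finite_subset)
    then have "card S = k" using Y k by simp
    then show "S \<in> Kbar_V n k" using Y k n by (auto simp: Kbar_V_def)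
  qed
  have touchQ: "\<exists>S\<in>L i. Kbar_E u S" if i: "i \<in> I" and u: "u \<in> Q" for i u
  proof -
    obtain Y where Y: "u = insert 1 Y" "Y \<subseteq> {2..n}" "card Y = k - 1" using u by (auto simp: Q_def)
    have "\<not> Y \<subseteq> {2..n} - \<Union>(L i)"
    proof
      assume "Y \<subseteq> {2..n} - \<Union>(L i)"
      then have "card Y \<le> card ({2..n} - \<Union>(L i))" by (intro card_mono) auto
      then show False using cover[OF i] Y k by simp
    qed
    then obtain x S where "x \<in> Y" "S \<in> L i" "x \<in> S" using Y by auto
    moreover have "u \<noteq> S" using \<open>S \<in> L i\<close> L[OF i] notQ u by blast
    ultimately show ?thesis using Y by (auto simp: Kbar_E_def)
  qed
  have touch: "\<exists>S\<in>L i. \<exists>T\<in>L j. Kbar_E S T" if i: "i \<in> I" and j: "j \<in> I" and ij: "i \<noteq> j" for i j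
  proof -
    have "card (({2..n} - \<Union>(L i)) \<union> ({2..n} - \<Union>(L j))) \<le> (k - 2) + (k - 2)"
      using card_Un_le[of "{2..n} - \<Union>(L i)" "{2..n} - \<Union>(L j)"] cover[OF i] cover[OF j] by linarith
    also have "\<dots> < card {2..n}" using k n by simp
    finally have "\<not> {2..n} \<subseteq> ({2..n} - \<Union>(L i)) \<union> ({2..n} - \<Union>(L j))"
      by (metis card_mono finite_Diff finite_Un finite_atLeastAtMost not_less)
    then obtain x S T where "S \<in> L i" "T \<in> L j" "x \<in> S" "x \<in> T" by auto
    moreover have "S \<noteq> T" using \<open>S \<in> L i\<close> \<open>T \<in> L j\<close> disj[OF i j ij] by blast
    ultimately show ?thesis by (auto simp: Kbar_E_def)
  qed
  have nonempty: "L i \<noteq> {}" if "i \<in> I" for i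
    using cover[OF that] k n by auto
  note minor = clique_stars_minor[of "Kbar_V n k" Kbar_E Q I L c]
  have sym: "Kbar_E v u" if "Kbar_E u v" for u v using that by (auto simp: Kbar_E_def)
  have cl: "Kbar_E u v" if "u \<in> Q" "v \<in> Q" "u \<noteq> v" for u v
    using that by (auto simp: Kbar_E_def Q_def)
  have LV: "L i \<subseteq> Kbar_V n k - Q" "c i \<in> Kbar_V n k - Q" if "i \<in> I" for i
    using L[OF that] c(1)[OF that] V notQ by auto
  have cE: "Kbar_E (c i) S" if "i \<in> I" "S \<in> L i" for i S
    using adj[OF that] c(2)[OF that(1)] that(2) by (auto simp: Kbar_E_def)
  show "strongly_1_shallow_Kt_minor (Kbar_V n k) Kbar_E (((n - 1) choose (k - 1)) + card I)"
    unfolding cardQ[symmetric]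
    by (rule minor(1)) (fact fin sym QV cl finI LV nonempty c(2) cE disj touchQ touch)+
  show "((n - 1) choose (k - 1)) + card I \<le> odd_hadwiger (Kbar_V n k) Kbar_E"
    unfolding cardQ[symmetric]
    by (rule minor(2)) (fact fin sym QV cl finI LV nonempty c(2) cE disj touchQ touch)+
qed

text \<open>Colour classes are families of pairwise disjoint sets; Baranyai's theorem supplies
  classes of size \<open>n div k\<close>, for which disjointness is possible.\<close>

lemma chromatic_number_Kbar_le:
  assumes k: "0 < k" "k \<le> n" and t: "n choose k \<le> t * (n div k)"
  shows "chromatic_number (Kbar_V n k) Kbar_E \<le> t"
proof -
  have q: "0 < n div k" using k by (simp add: div_greater_zero_iff)
  have le: "(n div k) * k \<le> n" by simp
  have ne: "finite {1..n}" "{1..n} \<noteq> {}" using k by simp_all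
  have t': "card {1..n} choose k \<le> t * (n div k)" using t by simp
  obtain \<phi> :: "nat set \<Rightarrow> nat" where \<phi>: "\<And>Z. Z \<subseteq> {1..n} \<Longrightarrow> card Z = k \<Longrightarrow> \<phi> Z < t"
    "\<And>i. Suc i * (n div k) \<le> card {1..n} choose k \<Longrightarrow> card {Z. Z \<subseteq> {1..n} \<and> card Z = k \<and> \<phi> Z = i} = (n div k)"
    "\<And>Y Z. (n div k) * k \<le> card {1..n} \<Longrightarrow> Y \<subseteq> {1..n} \<Longrightarrow> card Y = k \<Longrightarrow> Z \<subseteq> {1..n} \<Longrightarrow> card Z = k \<Longrightarrow> \<phi> Y = \<phi> Z \<Longrightarrow> Y \<noteq> Z \<Longrightarrow> Y \<inter> Z = {}"
    "\<And>i. Suc i * (n div k) \<le> card {1..n} choose k \<Longrightarrow> card ({1..n} - \<Union>{Z. Z \<subseteq> {1..n} \<and> card Z = k \<and> \<phi> Z = i}) \<le> card {1..n} - (n div k) * k"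
    by (fact baranyai_uniform[OF ne k(1) q t'])
  have "proper_colouring (Kbar_V n k) Kbar_E t \<phi>"
    unfolding proper_colouring_def Kbar_V_def Kbar_E_def using \<phi>(1,3) le by auto
  then show ?thesis unfolding chromatic_number_def by (intro Least_le) blast
qed

section \<open>Stars with two disjoint leaves\<close>

text \<open>The first \<open>T\<close> classes of pairs serve as leaves; each misses
  \<open>n - 1 - 2 * k \<le> k - 2\<close> points because \<open>n < 3 * k\<close>. Centres come
  from the remaining sets, and the hypothesis on \<open>T\<close> leaves at least \<open>T\<close>
  candidates for each star.\<close>

lemma Kbar_pair_bags:
  assumes k: "2 \<le> k" and n: "2 * k < n" "n < 3 * k"
    and T: "3 * T + 2 * ((n - 1 - k) choose k) \<le> (n - 1) choose k"
  shows "strongly_1_shallow_Kt_minor (Kbar_V n k) Kbar_E (((n - 1) choose (k - 1)) + T)"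
    and "((n - 1) choose (k - 1)) + T \<le> odd_hadwiger (Kbar_V n k) Kbar_E"
proof -
  define A where "A = {2..n}"
  have A: "finite A" "A \<noteq> {}" "card A = n - 1" using k n by (auto simp: A_def)
  have k0: "0 < k" using k by simp
  define V where "V = {Z. Z \<subseteq> A \<and> card Z = k}"
  have finV: "finite V" using A(1) by (simp add: V_def)
  have cV: "card V = (n - 1) choose k" unfolding V_def n_subsets[OF A(1)] A(3) ..
  have le: "card A choose k \<le> (card A choose k) * 2" by simp
  obtain \<phi> where \<phi>: "\<And>Z. Z \<subseteq> A \<Longrightarrow> card Z = k \<Longrightarrow> \<phi> Z < (card A choose k)"
    "\<And>i. Suc i * 2 \<le> card A choose k \<Longrightarrow> card {Z. Z \<subseteq> A \<and> card Z = k \<and> \<phi> Z = i} = 2"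
    "\<And>Y Z. 2 * k \<le> card A \<Longrightarrow> Y \<subseteq> A \<Longrightarrow> card Y = k \<Longrightarrow> Z \<subseteq> A \<Longrightarrow> card Z = k \<Longrightarrow> \<phi> Y = \<phi> Z \<Longrightarrow> Y \<noteq> Z \<Longrightarrow> Y \<inter> Z = {}"
    "\<And>i. Suc i * 2 \<le> card A choose k \<Longrightarrow> card (A - \<Union>{Z. Z \<subseteq> A \<and> card Z = k \<and> \<phi> Z = i}) \<le> card A - 2 * k"
    by (fact baranyai_uniform[OF A(1,2) k0 zero_less_numeral le])
  define L where "L i = {Z \<in> V. \<phi> Z = i}" for i
  have cL: "card (L i) = 2" and covL: "card (A - \<Union>(L i)) \<le> k - 2" if "i < T" for i
  proof -
    have "Suc i * 2 \<le> card A choose k" using that T by (simp add: A(3))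
    note * = \<phi>(2)[OF this] \<phi>(4)[OF this]
    have "L i = {Z. Z \<subseteq> A \<and> card Z = k \<and> \<phi> Z = i}" by (auto simp: L_def V_def)
    then show "card (L i) = 2" "card (A - \<Union>(L i)) \<le> k - 2" using * n A(3) by auto
  qed
  define N where "N i = {Z \<in> V. T \<le> \<phi> Z \<and> (\<forall>S\<in>L i. Z \<inter> S \<noteq> {})}" for i
  have "\<exists>c. inj_on c {..<T} \<and> (\<forall>i\<in>{..<T}. c i \<in> N i)"
  proof (rule ex_inj_choice)
    show "finite (N i)" for i using finV by (simp add: N_def)
    fix i assume "i \<in> {..<T}"
    then have i: "i < T" by simp
    have finL: "finite (L j)" for j using finV by (simp add: L_def)
    \<comment> \<open>Every set is used as a leaf, or is a candidate for the centre of star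
      \<open>i\<close>, or misses one of its two leaves.\<close>
    have "V \<subseteq> (\<Union>j<T. L j) \<union> N i \<union> (\<Union>S\<in>L i. {Z \<in> V. Z \<inter> S = {}})"
      by (auto simp: L_def N_def)
    then have "card V \<le> card ((\<Union>j<T. L j) \<union> N i \<union> (\<Union>S\<in>L i. {Z \<in> V. Z \<inter> S = {}}))"
      using finV finL by (intro card_mono) (auto simp: N_def)
    also have "\<dots> \<le> card (\<Union>j<T. L j) + card (N i) + card (\<Union>S\<in>L i. {Z \<in> V. Z \<inter> S = {}})"
      by (meson add_le_mono1 card_Un_le le_trans)
    also have "card (\<Union>j<T. L j) \<le> (\<Sum>j<T. card (L j))" by (rule card_UN_le) simp
    also have "\<dots> = 2 * T" using cL by simp
    also have "card (\<Union>S\<in>L i. {Z \<in> V. Z \<inter> S = {}}) \<le> (\<Sum>S\<in>L i. card {Z \<in> V. Z \<inter> S = {}})"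
      by (rule card_UN_le[OF finL])
    also have "\<dots> = (\<Sum>S\<in>L i. (n - 1 - k) choose k)"
    proof (rule sum.cong[OF refl])
      fix S assume "S \<in> L i"
      then have S: "S \<subseteq> A" "card S = k" by (auto simp: L_def V_def)
      have "{Z \<in> V. Z \<inter> S = {}} = {Z. Z \<subseteq> A - S \<and> card Z = k}" by (auto simp: V_def)
      moreover have "card (A - S) = n - 1 - k"
        using S A by (simp add: card_Diff_subset finite_subset)
      ultimately show "card {Z \<in> V. Z \<inter> S = {}} = (n - 1 - k) choose k"
        using A(1) by (simp add: n_subsets)
    qed
    also have "\<dots> = 2 * ((n - 1 - k) choose k)" using cL[OF i] by simp
    finally show "card {..<T} \<le> card (N i)" using T cV by simp
  qed simp
  then obtain c where c: "inj_on c {..<T}" "\<And>i. i < T \<Longrightarrow> c i \<in> N i" by auto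
  have c': "c i \<in> V" "T \<le> \<phi> (c i)" "\<And>S. S \<in> L i \<Longrightarrow> c i \<inter> S \<noteq> {}" if "i < T" for i
    using c(2)[OF that] by (auto simp: N_def)
  have disj: "insert (c i) (L i) \<inter> insert (c j) (L j) = {}" if "i < T" "j < T" "i \<noteq> j" for i j
  proof -
    have "c i \<noteq> c j" using c(1) that by (auto simp: inj_on_def)
    then show ?thesis using c'(2)[OF that(1)] c'(2)[OF that(2)] that by (auto simp: L_def)
  qed
  note bags = Kbar_star_bags[of k n "{..<T}" L c]
  show "strongly_1_shallow_Kt_minor (Kbar_V n k) Kbar_E (((n - 1) choose (k - 1)) + T)"
    using bags(1) k n c' covL disj by (force simp: L_def V_def A_def)
  show "((n - 1) choose (k - 1)) + T \<le> odd_hadwiger (Kbar_V n k) Kbar_E"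
    using bags(2) k n c' covL disj by (force simp: L_def V_def A_def)
qed

section \<open>Stars whose members share a point\<close>

text \<open>Each star consumes \<open>p + 1\<close> of the \<open>K\<close>-subsets of
  \<open>G\<close>: a class of \<open>p\<close> leaves and a centre from outside the first
  \<open>\<tau>\<close> classes. The centre is otherwise arbitrary, since the common point
  \<open>x\<close> makes it meet every leaf.\<close>

lemma apex_star_bags:
  fixes G :: "'a set"
  assumes G: "finite G" "G \<noteq> {}" and x: "x \<notin> G" and K: "0 < K" and p: "0 < p"
    and \<tau>: "\<tau> * (p + 1) \<le> card G choose K"
  defines "F \<equiv> insert x ` {Y. Y \<subseteq> G \<and> card Y = K}"
  shows "\<exists>L c. \<forall>i<\<tau>. L i \<subseteq> F \<and> L i \<noteq> {} \<and> c i \<in> F - L i \<and> card (G - \<Union>(L i)) \<le> card G - p * K \<and>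
    (\<forall>j<\<tau>. i \<noteq> j \<longrightarrow> insert (c i) (L i) \<inter> insert (c j) (L j) = {})"
proof -
  have t: "card G choose K \<le> (card G choose K) * p" using p by simp
  obtain \<phi> where \<phi>: "\<And>Z. Z \<subseteq> G \<Longrightarrow> card Z = K \<Longrightarrow> \<phi> Z < (card G choose K)"
    "\<And>i. Suc i * p \<le> card G choose K \<Longrightarrow> card {Z. Z \<subseteq> G \<and> card Z = K \<and> \<phi> Z = i} = p"
    "\<And>Y Z. p * K \<le> card G \<Longrightarrow> Y \<subseteq> G \<Longrightarrow> card Y = K \<Longrightarrow> Z \<subseteq> G \<Longrightarrow> card Z = K \<Longrightarrow> \<phi> Y = \<phi> Z \<Longrightarrow> Y \<noteq> Z \<Longrightarrow> Y \<inter> Z = {}"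
    "\<And>i. Suc i * p \<le> card G choose K \<Longrightarrow> card (G - \<Union>{Z. Z \<subseteq> G \<and> card Z = K \<and> \<phi> Z = i}) \<le> card G - p * K"
    by (fact baranyai_uniform[OF G K p t])
  define W where "W = {Y. Y \<subseteq> G \<and> card Y = K}"
  have finW: "finite W" and cW: "card W = card G choose K" using G(1) by (auto simp: W_def n_subsets)
  have xW: "insert x Y - {x} = Y" if "Y \<in> W" for Y using that x by (auto simp: W_def)
  define M where "M i = {Y \<in> W. \<phi> Y = i}" for i
  have M: "card (M i) = p" "card (G - \<Union>(M i)) \<le> card G - p * K" if "i < \<tau>" for i
  proof -
    have "Suc i * p \<le> \<tau> * p" using that by (intro mult_le_mono1) simp
    also have "\<dots> \<le> card G choose K" using \<tau> by simp
    finally have i: "Suc i * p \<le> card G choose K" .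
    have "M i = {Z. Z \<subseteq> G \<and> card Z = K \<and> \<phi> Z = i}" by (auto simp: M_def W_def)
    then show "card (M i) = p" "card (G - \<Union>(M i)) \<le> card G - p * K" using \<phi>(2)[OF i] \<phi>(4)[OF i] by auto
  qed
  define R where "R = {Y \<in> W. \<tau> \<le> \<phi> Y}"
  have "W \<subseteq> (\<Union>i<\<tau>. M i) \<union> R" by (auto simp: M_def R_def)
  then have "card W \<le> card ((\<Union>i<\<tau>. M i) \<union> R)"
    using finW by (intro card_mono) (auto simp: M_def R_def)
  also have "\<dots> \<le> card (\<Union>i<\<tau>. M i) + card R" by (rule card_Un_le)
  also have "card (\<Union>i<\<tau>. M i) \<le> (\<Sum>i<\<tau>. card (M i))" by (rule card_UN_le) simp
  also have "\<dots> = \<tau> * p" using M by simp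
  finally have "card {..<\<tau>} \<le> card R" using \<tau> cW by simp
  moreover have "finite R" using finW by (simp add: R_def)
  ultimately obtain d where d: "d ` {..<\<tau>} \<subseteq> R" "inj_on d {..<\<tau>}"
    using card_le_inj[of "{..<\<tau>}" R] by auto
  have d': "d i \<in> W" "\<tau> \<le> \<phi> (d i)" if "i < \<tau>" for i using d(1) that by (auto simp: R_def)
  \<comment> \<open>A label separating the bags: the leaves of star \<open>i\<close> have label
    \<open>i\<close>, all centres have labels at least \<open>\<tau>\<close>.\<close>
  define \<psi> where "\<psi> S = \<phi> (S - {x})" for S
  define L where "L i = insert x ` M i" for i
  define c where "c i = insert x (d i)" for i
  have \<psi>L: "\<psi> S = i" if "S \<in> L i" for S i using that xW by (auto simp: L_def M_def \<psi>_def)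
  have \<psi>c: "\<tau> \<le> \<psi> (c i)" if "i < \<tau>" for i using d'[OF that] xW by (simp add: c_def \<psi>_def)
  have cne: "c i \<noteq> c j" if "i < \<tau>" "j < \<tau>" "i \<noteq> j" for i j
  proof
    assume "c i = c j"
    then have "d i = d j" using xW d' that unfolding c_def by metis
    then show False using d(2) that by (auto simp: inj_on_def)
  qed
  show ?thesis
  proof (intro exI[of _ L] exI[of _ c] allI impI conjI)
    fix i assume i: "i < \<tau>"
    show "L i \<subseteq> F" by (auto simp: L_def M_def F_def W_def)
    have "M i \<noteq> {}" using M(1)[OF i] p by auto
    then show "L i \<noteq> {}" by (simp add: L_def)
    have "c i \<notin> L i" using \<psi>L \<psi>c[OF i] i by force
    moreover have "c i \<in> F" using d'(1)[OF i] by (simp add: c_def F_def W_def)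
    ultimately show "c i \<in> F - L i" by blast
    have "G - \<Union>(L i) \<subseteq> G - \<Union>(M i)" by (auto simp: L_def)
    then have "card (G - \<Union>(L i)) \<le> card (G - \<Union>(M i))" using G(1) by (intro card_mono) auto
    then show "card (G - \<Union>(L i)) \<le> card G - p * K" using M(2)[OF i] by linarith
    fix j assume j: "j < \<tau>" and ij: "i \<noteq> j"
    have "c i \<notin> L j" "c j \<notin> L i" using \<psi>L \<psi>c[OF i] \<psi>c[OF j] i j by force+
    moreover have "L i \<inter> L j = {}" using \<psi>L[of _ i] \<psi>L[of _ j] ij by blast
    ultimately show "insert (c i) (L i) \<inter> insert (c j) (L j) = {}" using cne[OF i j ij] by auto
  qed
qed

text \<open>Here \<open>s\<close> is the cyclic successor on \<open>{2, 3, 4}\<close>. A star with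
  apex \<open>x\<close> surely misses \<open>s (s x)\<close>, and of the \<open>n - 3\<close> points
  of \<open>G x\<close> at most \<open>k - 3\<close>, in total at most \<open>k - 2\<close>.\<close>

lemma Kbar_apex_bags:
  assumes k: "3 \<le> k" and n: "2 * k \<le> n"
    and p: "p = (n - 2) div (k - 1)" and \<tau>: "\<tau> * (p + 1) \<le> (n - 3) choose (k - 1)"
  shows "strongly_1_shallow_Kt_minor (Kbar_V n k) Kbar_E (((n - 1) choose (k - 1)) + 3 * \<tau>)"
    and "((n - 1) choose (k - 1)) + 3 * \<tau> \<le> odd_hadwiger (Kbar_V n k) Kbar_E"
proof -
  define A :: "nat set" where "A = {2, 3, 4}"
  define s :: "nat \<Rightarrow> nat" where "s x = (if x = 4 then 2 else x + 1)" for x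
  define G where "G x = insert (s x) {5..n}" for x
  define F where "F x = insert x ` {Y. Y \<subseteq> G x \<and> card Y = k - 1}" for x
  have G: "finite (G x)" "G x \<noteq> {}" "x \<notin> G x" "card (G x) = n - 3" "G x \<subseteq> {2..n}" "x \<in> {2..n}" if "x \<in> A" for x
    using that k n by (auto simp: G_def A_def s_def)
  have K: "0 < k - 1" using k by simp
  have "n - 2 < (k - 1) * (p + 1)" unfolding p using dividend_less_times_div[of "k - 1" "n - 2"] K by simp
  \<comment> \<open>The reason for the value of \<open>p\<close>: its leaves, of size
    \<open>k - 1\<close> without the apex, leave at most \<open>k - 3\<close> points of
    \<open>G x\<close> uncovered.\<close>
  then have pK: "n - k \<le> p * (k - 1)" by (simp add: algebra_simps)
  have p0: "0 < p" unfolding p using k n by (simp add: div_greater_zero_iff)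
  have "\<forall>x\<in>A. \<exists>Lc. \<forall>i<\<tau>. fst Lc i \<subseteq> F x \<and> fst Lc i \<noteq> {} \<and> snd Lc i \<in> F x - fst Lc i \<and>
      card (G x - \<Union>(fst Lc i)) \<le> card (G x) - p * (k - 1) \<and>
      (\<forall>j<\<tau>. i \<noteq> j \<longrightarrow> insert (snd Lc i) (fst Lc i) \<inter> insert (snd Lc j) (fst Lc j) = {})"
  proof
    fix x assume x: "x \<in> A"
    have "\<tau> * (p + 1) \<le> card (G x) choose (k - 1)" using \<tau> G(4)[OF x] by simp
    from apex_star_bags[OF G(1-3)[OF x] K p0 this, folded F_def]
    obtain L c where Lc: "\<forall>i<\<tau>. L i \<subseteq> F x \<and> L i \<noteq> {} \<and> c i \<in> F x - L i \<and> card (G x - \<Union>(L i)) \<le> card (G x) - p * (k - 1) \<and>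
      (\<forall>j<\<tau>. i \<noteq> j \<longrightarrow> insert (c i) (L i) \<inter> insert (c j) (L j) = {})" by (elim exE) (rule that)
    show "\<exists>Lc. \<forall>i<\<tau>. fst Lc i \<subseteq> F x \<and> fst Lc i \<noteq> {} \<and> snd Lc i \<in> F x - fst Lc i \<and>
      card (G x - \<Union>(fst Lc i)) \<le> card (G x) - p * (k - 1) \<and>
      (\<forall>j<\<tau>. i \<noteq> j \<longrightarrow> insert (snd Lc i) (fst Lc i) \<inter> insert (snd Lc j) (fst Lc j) = {})"
      by (rule exI[of _ "(L, c)"]) (unfold fst_conv snd_conv, rule Lc)
  qed
  from bchoice[OF this] obtain h where "\<forall>x\<in>A. \<forall>i<\<tau>. fst (h x) i \<subseteq> F x \<and> fst (h x) i \<noteq> {} \<and> snd (h x) i \<in> F x - fst (h x) i \<and>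
      card (G x - \<Union>(fst (h x) i)) \<le> card (G x) - p * (k - 1) \<and>
      (\<forall>j<\<tau>. i \<noteq> j \<longrightarrow> insert (snd (h x) i) (fst (h x) i) \<inter> insert (snd (h x) j) (fst (h x) j) = {})"
    by (elim exE) (rule that)
  note h = this[THEN bspec, THEN spec, THEN mp]
  define L where "L z = fst (h (fst z)) (snd z)" for z
  define c where "c z = snd (h (fst z)) (snd z)" for z
  have FV: "S \<subseteq> {2..n} \<and> card S = k" "x \<in> S" "S \<subseteq> insert x (G x)" if x: "x \<in> A" and S: "S \<in> F x" for x S
  proof -
    obtain Y where Y: "S = insert x Y" "Y \<subseteq> G x" "card Y = k - 1" using S by (auto simp: F_def)
    have "finite Y" "x \<notin> Y" using Y(2) G(1,3)[OF x] finite_subset by auto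
    then have "card S = k" using Y k by simp
    then show "S \<subseteq> {2..n} \<and> card S = k" "x \<in> S" "S \<subseteq> insert x (G x)" using Y G(5,6)[OF x] by auto
  qed
  have Fdisj: "F x \<inter> F y = {}" if "x \<in> A" "y \<in> A" "x \<noteq> y" for x y
  proof -
    have "x = 2 \<or> x = 3 \<or> x = 4" "y = 2 \<or> y = 3 \<or> y = 4" using that by (simp_all add: A_def)
    \<comment> \<open>Of two distinct apexes one is the successor of the other; the successor's
      family avoids its predecessor, which lies in every set of the other family.\<close>
    then have sep: "x \<notin> insert y (G y) \<or> y \<notin> insert x (G x)"
      using that(3) by (elim disjE) (simp_all add: G_def s_def)
    show ?thesis
    proof (rule equals0I)
      fix S assume "S \<in> F x \<inter> F y"
      then have "x \<in> S" "y \<in> S" "S \<subseteq> insert x (G x)" "S \<subseteq> insert y (G y)"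
        using FV(2,3)[OF that(1), of S] FV(2,3)[OF that(2), of S] by simp_all
      then show False using sep by blast
    qed
  qed
  define I where "I = A \<times> {..<\<tau>}"
  have finI: "finite I" and cI: "card I = 3 * \<tau>" by (auto simp: I_def A_def card_cartesian_product)
  have I: "fst z \<in> A" "snd z < \<tau>" if "z \<in> I" for z using that by (auto simp: I_def)
  have Lc: "L z \<subseteq> F (fst z)" "L z \<noteq> {}" "c z \<in> F (fst z)" "c z \<notin> L z"
    "card (G (fst z) - \<Union>(L z)) \<le> n - 3 - p * (k - 1)" if "z \<in> I" for z
    using h[OF I[OF that]] G(4)[OF I(1)[OF that]] by (auto simp: L_def c_def)
  have disj: "insert (c y) (L y) \<inter> insert (c z) (L z) = {}" if y: "y \<in> I" and z: "z \<in> I" and ne: "y \<noteq> z" for y z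
  proof (cases "fst y = fst z")
    case True
    then have "snd y \<noteq> snd z" using ne by (simp add: prod_eq_iff)
    then show ?thesis using h[OF I[OF y]] I(2)[OF z] True by (simp add: L_def c_def)
  next
    case False
    have "insert (c y) (L y) \<subseteq> F (fst y)" "insert (c z) (L z) \<subseteq> F (fst z)" using Lc[OF y] Lc[OF z] by auto
    then show ?thesis using Fdisj[OF I(1)[OF y] I(1)[OF z] False] by blast
  qed
  have cover: "card ({2..n} - \<Union>(L z)) \<le> k - 2" if z: "z \<in> I" for z
  proof -
    let ?x = "fst z"
    have x: "?x \<in> A" using I(1)[OF z] .
    have "?x \<in> \<Union>(L z)" using Lc(1,2)[OF z] FV(2)[OF x] by blast
    moreover have "{2..n} \<subseteq> A \<union> {5..n}" by (auto simp: A_def)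
    moreover have "A \<subseteq> {?x, s ?x, s (s ?x)}" using x by (auto simp: A_def s_def)
    ultimately have "{2..n} - \<Union>(L z) \<subseteq> insert (s (s ?x)) (G ?x - \<Union>(L z))" unfolding G_def by blast
    then have "card ({2..n} - \<Union>(L z)) \<le> card (insert (s (s ?x)) (G ?x - \<Union>(L z)))"
      using G(1)[OF x] by (intro card_mono) auto
    also have "\<dots> \<le> Suc (card (G ?x - \<Union>(L z)))" by (rule card_insert_le_m1) auto
    also have "\<dots> \<le> Suc (n - 3 - p * (k - 1))" using Lc(5)[OF z] by simp
    also have "\<dots> \<le> k - 2" using pK k n by simp
    finally show ?thesis .
  qed
  have LV: "S \<subseteq> {2..n} \<and> card S = k" if "z \<in> I" "S \<in> L z" for z S
    using FV(1)[OF I(1)[OF that(1)]] Lc(1)[OF that(1)] that(2) by blast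
  have cV: "c z \<subseteq> {2..n} \<and> card (c z) = k" if "z \<in> I" for z
    using FV(1)[OF I(1)[OF that]] Lc(3)[OF that] by blast
  have adj: "c z \<inter> S \<noteq> {}" if "z \<in> I" "S \<in> L z" for z S
    using FV(2)[OF I(1)[OF that(1)]] Lc(1,3)[OF that(1)] that(2) by blast
  have k2: "2 \<le> k" using k by simp
  show "strongly_1_shallow_Kt_minor (Kbar_V n k) Kbar_E (((n - 1) choose (k - 1)) + 3 * \<tau>)"
    unfolding cI[symmetric]
    by (rule Kbar_star_bags(1)[where L = L and c = c]) (fact k2 n finI LV cV Lc(4) adj disj cover)+
  show "((n - 1) choose (k - 1)) + 3 * \<tau> \<le> odd_hadwiger (Kbar_V n k) Kbar_E"
    unfolding cI[symmetric]
    by (rule Kbar_star_bags(2)[where L = L and c = c]) (fact k2 n finI LV cV Lc(4) adj disj cover)+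
qed

text \<open>For \<open>k = 2\<close> the leaves must cover all of \<open>{2..n}\<close>. The leaves
  \<open>{2, j}\<close> miss only \<open>3\<close>, which \<open>{3, 4}\<close> supplies, and the
  centre \<open>{2, 3}\<close> meets them all.\<close>

lemma Kbar_2_bag:
  assumes n: "5 \<le> n"
  shows "strongly_1_shallow_Kt_minor (Kbar_V n 2) Kbar_E n" and "n \<le> odd_hadwiger (Kbar_V n 2) Kbar_E"
proof -
  define L :: "unit \<Rightarrow> nat set set" where "L = (\<lambda>_. insert {3, 4} ((\<lambda>j. {2, j}) ` {4..n}))"
  define c :: "unit \<Rightarrow> nat set" where "c = (\<lambda>_. {2, 3})"
  have "{2..n} - \<Union>(L ()) = {}" using n by (auto simp: L_def)
  then have cover: "card ({2..n} - \<Union>(L i)) \<le> 2 - 2" for i by simp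
  have LV: "S \<subseteq> {2..n} \<and> card S = 2" if "S \<in> L i" for i S using that n by (auto simp: L_def)
  have cV: "c i \<subseteq> {2..n} \<and> card (c i) = 2" "c i \<notin> L i" for i using n by (auto simp: c_def L_def doubleton_eq_iff)
  have adj: "c i \<inter> S \<noteq> {}" if "S \<in> L i" for i S using that by (auto simp: c_def L_def)
  have eq: "((n - 1) choose (2 - 1)) + card {()} = n" using n by simp
  show "strongly_1_shallow_Kt_minor (Kbar_V n 2) Kbar_E n"
    by (subst eq[symmetric], rule Kbar_star_bags(1)[where L = L and c = c]) (use n cover LV cV adj in auto)
  show "n \<le> odd_hadwiger (Kbar_V n 2) Kbar_E"
    by (subst eq[symmetric], rule Kbar_star_bags(2)[where L = L and c = c]) (use n cover LV cV adj in auto)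
qed

section \<open>Comparing the number of stars with the chromatic number\<close>

lemma Suc_mult_choose_Suc: "Suc k * (n choose Suc k) = (n - k) * (n choose k)"
  using binomial_absorption[of k n] binomial_absorb_comp[of n k] by simp

text \<open>The left binomial coefficient counts the centres lost to a single leaf. Two terms of
  Vandermonde's sum for \<open>(n - 1) choose (k - 1)\<close> already give \<open>k * y\<close>, and
  \<open>b \<le> 2 * k - 2\<close> bounds the ratios of the neighbouring coefficients
  \<open>x\<close>, \<open>y\<close>, \<open>z\<close>.\<close>

lemma choose_disjoint_bound:
  assumes k: "2 \<le> k" and n: "2 * k < n" "n < 3 * k"
  shows "(k + 1) * ((n - 1 - k) choose k) \<le> (n - 1) choose (k - 1)"
proof -
  define b where "b = n - 1 - k"
  obtain m where m: "k = m + 2" using k by (metis add.commute le_Suc_ex)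
  have b: "k \<le> b" "b \<le> 2 * k - 2" "n - 1 = b + k" using n by (auto simp: b_def)
  define x y z where "x = b choose k" and "y = b choose (k - 1)" and "z = b choose (k - 2)"
  have kx: "k * x = (b - (k - 1)) * y" using Suc_mult_choose_Suc[of "k - 1" b] k by (simp add: x_def y_def)
  have "(k - 1) * y = (b - (k - 2)) * z" using Suc_mult_choose_Suc[of "k - 2" b] m by (simp add: y_def z_def)
  also have "\<dots> \<le> k * z" using b by (intro mult_le_mono1) simp
  finally have yz: "(k - 1) * y \<le> k * z" .
  have "(\<Sum>j\<in>{k - 2, k - 1}. (b choose j) * (k choose (k - 1 - j))) \<le> (\<Sum>j\<le>k - 1. (b choose j) * (k choose (k - 1 - j)))"
    by (rule sum_mono2) auto
  then have "k * z + y \<le> (n - 1) choose (k - 1)"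
    unfolding vandermonde b(3) using m by (simp add: z_def y_def mult.commute)
  then have c: "k * y \<le> (n - 1) choose (k - 1)" using yz m by (simp add: algebra_simps)
  have "k * x \<le> (k - 1) * y" unfolding kx using b by (intro mult_le_mono1) simp
  then have "k * (k * x) \<le> (k - 1) * (k * y)" by (metis mult.left_commute mult_le_mono2)
  also have "\<dots> \<le> (k - 1) * ((n - 1) choose (k - 1))" using c by (rule mult_le_mono2)
  finally have "k * k * x \<le> (k - 1) * ((n - 1) choose (k - 1))" by (simp add: mult.assoc)
  moreover have "(k - 1) * ((k + 1) * x) \<le> k * k * x" using m by (simp add: algebra_simps)
  ultimately have "(k - 1) * ((k + 1) * x) \<le> (k - 1) * ((n - 1) choose (k - 1))" by linarith
  then show ?thesis using k by (simp add: x_def b_def)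
qed

text \<open>The source of the exponential term. With \<open>m = k - 1\<close> the coefficient is at
  least \<open>((n - 1) / m) ^ m\<close>, hence at least \<open>2 ^ m * (1 + 1 / m) ^ m\<close>,
  where Bernoulli's inequality bounds the second factor by 2; moreover \<open>(4/3) ^ 2\<close>
  exceeds \<open>3/2\<close>.\<close>

lemma choose_ge_three_halves_power:
  assumes k: "3 \<le> k" and n: "2 * k < n"
  shows "3 * (3/2::real) ^ (k - 1) \<le> real ((n - 1) choose (k - 1))"
proof -
  define m where "m = k - 1"
  have m: "2 \<le> m" "k = m + 1" using k by (auto simp: m_def)
  have "3 * (3/2::real) ^ m \<le> 2 * 2 ^ m"
  proof -
    have "(4/3::real) ^ 2 \<le> (4/3) ^ m" using m by (intro power_increasing) auto
    then have "3/2 * (3/2::real) ^ m \<le> (4/3) ^ m * (3/2) ^ m" by (intro mult_right_mono) (auto simp: power2_eq_square)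
    also have "\<dots> = 2 ^ m" by (simp flip: power_mult_distrib)
    finally show ?thesis by simp
  qed
  also have "\<dots> \<le> (1 + 1 / real m) ^ m * 2 ^ m"
    using Bernoulli_inequality[OF order_trans[of "- 1" 0 "1 / real m"], of m] m by (intro mult_right_mono) auto
  also have "\<dots> = (2 * (real m + 1) / real m) ^ m" using m by (simp flip: power_mult_distrib add: field_simps)
  also have "\<dots> \<le> (real (n - 1) / real m) ^ m"
    using m n by (intro power_mono divide_right_mono) auto
  also have "\<dots> \<le> real ((n - 1) choose m)"
    using m n by (intro binomial_ge_n_over_k_pow_k) auto
  finally show ?thesis by (simp add: m_def)
qed

text \<open>Up to rounding the gain is \<open>C / 2 - N / 6 - 2 * B / 3\<close>, which is at least
  \<open>C / 18\<close> and so at least one sixth of the power. Rounding costs at most 2/3 in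
  \<open>T\<close> and 1/2 in the chromatic bound, together 7/6.\<close>

lemma pair_bags_gain:
  assumes k: "3 \<le> k" and n: "2 * k < n" "n < 3 * k"
  defines "T \<equiv> (((n - 1) choose k) - 2 * ((n - 1 - k) choose k)) div 3"
  shows "((3/2::real) ^ (k - 1) - 7) / 6 \<le> real (((n - 1) choose (k - 1)) + T) - real (((n choose k) + 1) div 2)"
    and "((n choose k) + 1) div 2 \<le> ((n - 1) choose (k - 1)) + T"
proof -
  define C N B where "C = (n - 1) choose (k - 1)" and "N = (n - 1) choose k" and "B = (n - 1 - k) choose k"
  define t where "t = (C + N + 1) div 2"
  have "n choose k = C + N" using choose_reduce_nat[of n k] k n by (simp add: C_def N_def)
  then have t: "((n choose k) + 1) div 2 = t" by (simp add: t_def)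
  have CB: "real (k + 1) * real B \<le> real C"
    using choose_disjoint_bound[of k n] k n by (simp only: B_def C_def flip: of_nat_mult of_nat_le_iff[where ?'a=real])
  have "k * N = (n - k) * C" using Suc_mult_choose_Suc[of "k - 1" "n - 1"] k n by (simp add: N_def C_def)
  also have "\<dots> \<le> (2 * k - 1) * C" using n by (intro mult_le_mono1) simp
  finally have "real (k * N) \<le> real ((2 * k - 1) * C)" by (rule of_nat_mono)
  then have CN: "real k * real N \<le> (2 * real k - 1) * real C" using k by (simp add: of_nat_diff)
  have key: "real C / 18 \<le> real C / 2 - real N / 6 - 2 * real B / 3"
  proof -
    let ?k = "real k"
    have k3: "?k \<ge> 3" using k by simp
    define N' B' where "N' = (2 * ?k - 1) * real C / ?k" and "B' = real C / (?k + 1)"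
    have N: "real N \<le> N'" using CN k3 by (simp add: N'_def field_simps)
    have B: "real B \<le> B'" using CB k3 by (simp add: B'_def field_simps)
    \<comment> \<open>The next inequality with its denominators cleared; equality holds at
      \<open>k = 3\<close>, which explains the constant 18.\<close>
    have "0 \<le> (2 * ?k - 1) * (?k - 3)" using k3 by simp
    then have "1/18 \<le> (?k - 1)^2 / (6 * ?k * (?k + 1))"
      using k3 by (simp add: field_simps power2_eq_square)
    then have "real C * (1/18) \<le> real C * ((?k - 1)^2 / (6 * ?k * (?k + 1)))" by (intro mult_left_mono) auto
    also have "\<dots> = real C / 2 - N' / 6 - 2 * B' / 3"
      using k3 unfolding N'_def B'_def by (simp add: divide_simps power2_eq_square) (simp add: algebra_simps)
    finally show ?thesis using N B by linarith
  qed
  have T: "real N - 2 * real B - 2 \<le> 3 * real T"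
  proof -
    have "N - 2 * B \<le> 3 * T + 2" unfolding T_def N_def B_def by simp
    then have "N \<le> 3 * T + 2 + 2 * B" by simp
    then show ?thesis by linarith
  qed
  have t2: "2 * real t \<le> real C + real N + 1"
  proof -
    have "2 * t \<le> C + N + 1" by (simp add: t_def)
    then show ?thesis by linarith
  qed
  define X where "X = (3/2::real) ^ (k - 1)"
  have C3: "3 * X \<le> real C" using choose_ge_three_halves_power[OF k n(1)] by (simp add: C_def X_def)
  have X1: "1 < X" unfolding X_def using k by (intro one_less_power) auto
  show "((3/2::real) ^ (k - 1) - 7) / 6 \<le> real (((n - 1) choose (k - 1)) + T) - real (((n choose k) + 1) div 2)"
    unfolding t C_def[symmetric] X_def[symmetric] of_nat_add using key T t2 C3 by argo
  \<comment> \<open>Since the power exceeds 1, the gain exceeds \<open>-1\<close>, and integrality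
    makes it nonnegative.\<close>
  then have "real t - 1 < real (C + T)"
    unfolding t C_def[symmetric] X_def[symmetric] using X1 by argo
  then show "((n choose k) + 1) div 2 \<le> ((n - 1) choose (k - 1)) + T"
    unfolding t C_def[symmetric] by linarith
qed

text \<open>The substitutions are chosen such that the difference of the two sides becomes a polynomial with
  positive coefficients in nonnegative variables.\<close>

lemma apex_polynomial_bound:
  fixes n k r :: real
  assumes k: "3 \<le> k" and r: "1 \<le> r" "r \<le> k - 1" and nr: "n = 3 * k + r \<and> r \<le> k - 2 \<or> 4 * k - 1 \<le> n"
  shows "r * (n - 1) * (n - 2) * (n + k - 3) * ((n - 3) * (n - 4)) + 6 * (n - r) * ((n - k) * (n - k - 1)) * (n + k - 3)
    \<le> 3 * (k - 1) * (n - r) * ((n - k) * (n - k - 1)) * ((n - 3) * (n - 4))"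
  using nr
proof
  assume n: "n = 3 * k + r \<and> r \<le> k - 2"
  define u v where "u = r - 1" and "v = k - r - 2"
  have uv: "0 \<le> u" "0 \<le> v" using r n by (auto simp: u_def v_def)
  have eqs: "r = u + 1" "k = u + v + 3" "n = 4 * u + 3 * v + 10" using n by (auto simp: u_def v_def)
  have "3 * (k - 1) * (n - r) * ((n - k) * (n - k - 1)) * ((n - 3) * (n - 4))
      - (r * (n - 1) * (n - 2) * (n + k - 3) * ((n - 3) * (n - 4)) + 6 * (n - r) * ((n - k) * (n - k - 1)) * (n + k - 3))
    = 16 * u^6 + 1400 * u^5 * v + 2868 * u^5 + 5145 * u^4 * v^2 + 23615 * u^4 * v + 25648 * u^4 + 7686 * u^3 * v^3 +
      54906 * u^3 * v^2 + 126418 * u^3 * v + 91716 * u^3 + 5760 * u^2 * v^4 + 55890 * u^2 * v^3 + 198357 * u^2 * v^2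
      + 300847 * u^2 * v + 160168 * u^2 + 2160 * u * v^5 + 26496 * u * v^4 + 127404 * u * v^3 + 297060 * u * v^2 +
      329808 * u * v + 134448 * u + 324 * v^6 + 4806 * v^5 + 29196 * v^4 + 92214 * v^3 + 157536 * v^2 + 134532 * v +
      42336"
    unfolding eqs by algebra
  also have "\<dots> \<ge> 0" using uv by (intro add_nonneg_nonneg mult_nonneg_nonneg zero_le_power) auto
  finally show ?thesis by simp
next
  assume n: "4 * k - 1 \<le> n"
  define u v where "u = n - 4 * k + 1" and "v = k - 3"
  have uv: "0 \<le> u" "0 \<le> v" using n k by (auto simp: u_def v_def)
  have eqs: "k = v + 3" "n = u + 4 * v + 11" by (auto simp: u_def v_def)
  define P Q where "P = (n - k) * (n - k - 1)" and "Q = (n - 3) * (n - 4)"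
  have P: "0 \<le> P" "P \<le> (n - 1) * (n - 2)" using n k unfolding P_def by (auto intro!: mult_mono)
  have "7 * 6 \<le> (n - 3) * (n - 4)" using n k by (intro mult_mono) auto
  then have Q: "6 \<le> Q" by (simp add: Q_def)
  have "P * 6 \<le> (n - 1) * (n - 2) * Q" using P Q n k by (intro mult_mono) auto
  then have "P * 6 * (n + k - 3) \<le> (n - 1) * (n - 2) * Q * (n + k - 3)" using n k by (intro mult_right_mono) auto
  moreover have "0 \<le> 3 * (k - 1) * P * Q" using P Q k by simp
  \<comment> \<open>The difference of the two sides is affine and decreasing in \<open>r\<close>.
    This product is its drop from \<open>r\<close> to \<open>k - 1\<close>, so only the worst case
    \<open>r = k - 1\<close> remains.\<close>
  ultimately have "0 \<le> (k - 1 - r) * (3 * (k - 1) * P * Q + (n - 1) * (n - 2) * Q * (n + k - 3) - P * 6 * (n + k - 3))"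
    using r by (intro mult_nonneg_nonneg) linarith+
  moreover have "0 \<le> 2 * u^5 * v + 4 * u^5 + 30 * u^4 * v^2 + 132 * u^4 * v + 138 * u^4 + 169 * u^3 * v^3 + 1177 * u^3 * v^2 + 2610
      * u^3 * v + 1822 * u^3 + 425 * u^2 * v^4 + 4213 * u^2 * v^3 + 14818 * u^2 * v^2 + 21854 * u^2 * v + 11238 *
      u^2 + 408 * u * v^5 + 5835 * u * v^4 + 30074 * u * v^3 + 71417 * u * v^2 + 78100 * u * v + 30718 * u + 16 *
      v^6 + 1564 * v^5 + 14758 * v^4 + 56230 * v^3 + 103090 * v^2 + 87430 * v + 25200"
    using uv by (intro add_nonneg_nonneg mult_nonneg_nonneg zero_le_power) auto
  moreover have "\<dots> = 3 * (k - 1) * (n - (k - 1)) * P * Q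
      - ((k - 1) * (n - 1) * (n - 2) * (n + k - 3) * Q + 6 * (n - (k - 1)) * P * (n + k - 3))"
    unfolding P_def Q_def eqs by algebra
  ultimately show ?thesis unfolding P_def[symmetric] Q_def[symmetric] by (simp add: algebra_simps)
qed

text \<open>With \<open>n = q * k + r\<close> and \<open>k * (n choose k) = n * C\<close>, the claim
  reduces to \<open>r * C \<le> 3 * (n - r) * \<tau>\<close>. Expressing \<open>C\<close> through
  \<open>Y\<close> and bounding \<open>\<tau>\<close> below in terms of \<open>Y\<close> turns this
  into the polynomial inequality.\<close>

lemma apex_bags_suffice:
  assumes k: "3 \<le> k" and n: "3 * k \<le> n" and ndvd: "\<not> k dvd n"
  shows "n choose k \<le> (((n - 1) choose (k - 1)) + 3 * (((n - 3) choose (k - 1)) div ((n - 2) div (k - 1) + 1))) * (n div k)"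
proof -
  define q r where "q = n div k" and "r = n mod k"
  have nqr: "n = q * k + r" by (simp add: q_def r_def)
  have r: "1 \<le> r" "r < k" using ndvd k by (auto simp: r_def dvd_eq_mod_eq_0 Suc_le_eq)
  have q: "3 \<le> q" using n k unfolding q_def by (simp add: less_eq_div_iff_mult_less_eq)
  define C Y p \<tau> where "C = (n - 1) choose (k - 1)" and "Y = (n - 3) choose (k - 1)" and "p = (n - 2) div (k - 1)" and "\<tau> = Y div (p + 1)"
  have n3: "3 * k + r \<le> n" using nqr mult_le_mono1[OF q, of k] by simp
  let ?n = "real n" and ?k = "real k" and ?r = "real r"
  \<comment> \<open>For \<open>q = 3\<close> and \<open>r = k - 1\<close> one has
    \<open>n = 4 * k - 1\<close>, so this borderline case joins \<open>q \<ge> 4\<close>.\<close>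
  have disj: "?n = 3 * ?k + ?r \<and> ?r \<le> ?k - 2 \<or> 4 * ?k - 1 \<le> ?n"
  proof (cases "q = 3")
    case True
    then have "?n = 3 * ?k + ?r" using nqr by simp
    moreover have "r + 2 \<le> k \<or> r + 1 = k" using r by linarith
    then have "real r + 2 \<le> real k \<or> real r + 1 = real k" by (auto simp flip: of_nat_add)
    ultimately show ?thesis by auto
  next
    case False
    then have "4 * k \<le> q * k" using q by (intro mult_le_mono1) simp
    then have "4 * k \<le> n" using nqr by linarith
    then show ?thesis by linarith
  qed
  define P Q where "P = (?n - ?k) * (?n - ?k - 1)" and "Q = (?n - 3) * (?n - 4)"
  have P: "0 < P" unfolding P_def using n k by (intro mult_pos_pos) auto
  have poly: "?r * (?n - 1) * (?n - 2) * (?n + ?k - 3) * Q + 6 * (?n - ?r) * P * (?n + ?k - 3) \<le> 3 * (?k - 1) * (?n - ?r) * P * Q"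
    unfolding P_def Q_def using apex_polynomial_bound[of ?k ?r ?n] k r disj by simp
  have Q: "0 < Q" unfolding Q_def using n k by (intro mult_pos_pos) auto
  \<comment> \<open>Binomial coefficients increase up to the middle, so \<open>Y\<close> is at least
    \<open>(n - 3) choose 2\<close>.\<close>
  have Y: "Q \<le> 2 * real Y"
  proof -
    have "(n - 3) choose 2 \<le> Y" unfolding Y_def using k n3 r by (intro binomial_mono) auto
    moreover have "2 * ((n - 3) choose 2) = (n - 3) * (n - 4)"
      using times_binomial_minus1_eq[of 2 "n - 3"] by simp
    ultimately have "(n - 3) * (n - 4) \<le> 2 * Y" by linarith
    then have "real ((n - 3) * (n - 4)) \<le> real (2 * Y)" by (rule of_nat_mono)
    then show ?thesis unfolding Q_def using n k by (simp add: of_nat_diff)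
  qed
  have CY: "P * real C = (?n - 1) * (?n - 2) * real Y"
  proof -
    define Z where "Z = (n - 2) choose (k - 1)"
    have "(n - k) * C = (n - 1) * Z" using binomial_absorb_comp[of "n - 1" "k - 1"] k n
      by (simp add: C_def Z_def numeral_eq_Suc)
    then have "real ((n - k) * C) = real ((n - 1) * Z)" by simp
    then have 1: "(?n - ?k) * real C = (?n - 1) * real Z" using k n by (simp add: of_nat_diff)
    have "(n - k - 1) * Z = (n - 2) * Y" using binomial_absorb_comp[of "n - 2" "k - 1"] k n
      by (simp add: Y_def Z_def numeral_eq_Suc)
    then have "real ((n - k - 1) * Z) = real ((n - 2) * Y)" by simp
    then have 2: "(?n - ?k - 1) * real Z = (?n - 2) * real Y" using k n by (simp add: of_nat_diff diff_diff_eq add.commute)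
    have "P * real C = (?n - ?k - 1) * ((?n - ?k) * real C)" by (simp add: P_def)
    also have "\<dots> = (?n - 1) * ((?n - ?k - 1) * real Z)" unfolding 1 by simp
    finally show ?thesis unfolding 2 by simp
  qed
  have \<tau>: "(?k - 1) * real Y \<le> (real \<tau> + 1) * (?n + ?k - 3)"
  proof -
    have "Y < (\<tau> + 1) * (p + 1)" unfolding \<tau>_def using dividend_less_div_times[of "p + 1" Y] by simp
    then have "Y \<le> (\<tau> + 1) * (p + 1)" by simp
    then have "(k - 1) * Y \<le> (k - 1) * ((\<tau> + 1) * (p + 1))" by (rule mult_le_mono2)
    also have "\<dots> = (\<tau> + 1) * ((k - 1) * p + (k - 1))"
      by (metis distrib_left mult.left_commute mult_1_right)
    also have "\<dots> \<le> (\<tau> + 1) * (n - 2 + (k - 1))"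
      by (intro mult_le_mono2 add_le_mono1) (simp add: p_def)
    finally have "real ((k - 1) * Y) \<le> real ((\<tau> + 1) * (n - 2 + (k - 1)))" by (rule of_nat_mono)
    then have "real (k - 1) * real Y \<le> (real \<tau> + 1) * (real (n - 2) + real (k - 1))"
      by (simp only: of_nat_mult of_nat_add of_nat_1)
    moreover have "real (k - 1) = ?k - 1" "real (n - 2) = ?n - 2" using k n by (simp_all add: of_nat_diff)
    ultimately show ?thesis by (simp add: algebra_simps)
  qed
  have "?r * real C \<le> 3 * (?n - ?r) * real \<tau>"
  proof -
    let ?s = "?n + ?k - 3"
    have s: "0 < ?s" using k n by simp
    have nr: "0 \<le> ?n - ?r" using n3 by simp
    \<comment> \<open>The division defining \<open>\<tau>\<close> loses at most 1, which
      \<open>2 * Y / Q \<ge> 1\<close> pays for; hence the factor 6 in \<open>poly\<close>.\<close>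
    have slack: "3 * (?n - ?r) * P * ?s * Q \<le> 3 * (?n - ?r) * P * ?s * (2 * real Y)"
      using nr P s Y by (intro mult_left_mono) auto
    have "real Y * (?r * (?n - 1) * (?n - 2) * ?s * Q) + real Y * (6 * (?n - ?r) * P * ?s) \<le> real Y * (3 * (?k - 1) * (?n - ?r) * P * Q)"
      using mult_left_mono[OF poly, of "real Y"] by (simp add: algebra_simps)
    with slack have "Q * (?r * ((?n - 1) * (?n - 2) * real Y) * ?s + 3 * (?n - ?r) * P * ?s) \<le> Q * (3 * (?n - ?r) * P * ((?k - 1) * real Y))"
      by (simp add: algebra_simps)
    then have "?r * ((?n - 1) * (?n - 2) * real Y) * ?s + 3 * (?n - ?r) * P * ?s \<le> 3 * (?n - ?r) * P * ((?k - 1) * real Y)"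
      using Q by simp
    also have "\<dots> \<le> 3 * (?n - ?r) * P * ((real \<tau> + 1) * ?s)" using \<tau> nr P by (intro mult_left_mono) auto
    finally have "(P * ?s) * (?r * real C) \<le> (P * ?s) * (3 * (?n - ?r) * real \<tau>)"
      unfolding CY[symmetric] by (simp add: algebra_simps)
    then show ?thesis using P s by simp
  qed
  moreover have nr: "?n - ?r = real q * ?k" using nqr by simp
  ultimately have "real (r * C) \<le> real (3 * (q * k) * \<tau>)" by simp
  then have rC: "r * C \<le> 3 * (q * k) * \<tau>" by (simp only: of_nat_le_iff)
  have "k * (n choose k) = n * C" using times_binomial_minus1_eq[of k n] k by (simp add: C_def)
  also have "\<dots> = q * k * C + r * C" by (simp add: nqr algebra_simps)
  also have "\<dots> \<le> q * k * C + 3 * (q * k) * \<tau>" using rC by simp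
  also have "\<dots> = k * ((C + 3 * \<tau>) * q)" by (simp add: algebra_simps)
  finally have "n choose k \<le> (C + 3 * \<tau>) * q" using k by simp
  then show ?thesis by (simp add: C_def \<tau>_def Y_def p_def q_def)
qed

section \<open>Assembling the cases\<close>

text \<open>The number of stars is the largest that \<open>Kbar_pair_bags\<close> admits. As
  \<open>n div k = 2\<close>, the chromatic number is at most half of \<open>n choose k\<close>,
  rounded up.\<close>

lemma Kbar_pair_bags_gain:
  assumes k: "3 \<le> k" and n: "2 * k < n" "n < 3 * k"
  defines "t \<equiv> ((n - 1) choose (k - 1)) + (((n - 1) choose k) - 2 * ((n - 1 - k) choose k)) div 3"
  shows "strongly_1_shallow_Kt_minor (Kbar_V n k) Kbar_E t" and "t \<le> odd_hadwiger (Kbar_V n k) Kbar_E"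
    and "chromatic_number (Kbar_V n k) Kbar_E \<le> t"
    and "((3/2::real) ^ (k - 1) - 7) / 6 \<le> real t - real (chromatic_number (Kbar_V n k) Kbar_E)"
proof -
  have k2: "2 \<le> k" using k by simp
  \<comment> \<open>Shows that the natural-number subtraction in \<open>t\<close> is not
    truncated.\<close>
  have "2 * ((n - 1 - k) choose k) \<le> (k + 1) * ((n - 1 - k) choose k)" using k by (intro mult_le_mono1) simp
  also have "\<dots> \<le> (n - 1) choose (k - 1)" by (rule choose_disjoint_bound[OF k2 n])
  also have "\<dots> \<le> (n - 1) choose k" using n by (intro binomial_mono) auto
  finally have T: "3 * ((((n - 1) choose k) - 2 * ((n - 1 - k) choose k)) div 3) + 2 * ((n - 1 - k) choose k) \<le> (n - 1) choose k"
    by linarith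
  show "strongly_1_shallow_Kt_minor (Kbar_V n k) Kbar_E t" "t \<le> odd_hadwiger (Kbar_V n k) Kbar_E"
    unfolding t_def by (rule Kbar_pair_bags[OF k2 n T])+
  have "n div k = 2" using n k by (intro div_nat_eqI) auto
  then have "chromatic_number (Kbar_V n k) Kbar_E \<le> ((n choose k) + 1) div 2"
    using k n by (intro chromatic_number_Kbar_le) auto
  then show "chromatic_number (Kbar_V n k) Kbar_E \<le> t"
    "((3/2::real) ^ (k - 1) - 7) / 6 \<le> real t - real (chromatic_number (Kbar_V n k) Kbar_E)"
    using pair_bags_gain[OF k n] unfolding t_def by linarith+
qed

lemma Kbar_minor_ge_chromatic_number:
  assumes k: "2 \<le> k" and n: "2 * k \<le> n"
  obtains t where "chromatic_number (Kbar_V n k) Kbar_E \<le> t"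
    "strongly_1_shallow_Kt_minor (Kbar_V n k) Kbar_E t" "t \<le> odd_hadwiger (Kbar_V n k) Kbar_E"
proof -
  consider "k dvd n" | "\<not> k dvd n" "k = 2" | "\<not> k dvd n" "3 \<le> k" "n < 3 * k" | "\<not> k dvd n" "3 \<le> k" "3 * k \<le> n"
    using k by linarith
  then show thesis
  proof cases
    case 1
    have "k * (n choose k) = n * ((n - 1) choose (k - 1))" using k by (intro times_binomial_minus1_eq) simp
    also have "\<dots> = k * (((n - 1) choose (k - 1)) * (n div k))" using 1 by (metis dvd_mult_div_cancel mult.assoc mult.commute)
    finally have "n choose k \<le> ((n - 1) choose (k - 1)) * (n div k)" using k by simp
    then have "chromatic_number (Kbar_V n k) Kbar_E \<le> (n - 1) choose (k - 1)"
      using k n by (intro chromatic_number_Kbar_le) auto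
    moreover have "strongly_1_shallow_Kt_minor (Kbar_V n k) Kbar_E ((n - 1) choose (k - 1))"
      "(n - 1) choose (k - 1) \<le> odd_hadwiger (Kbar_V n k) Kbar_E"
      using Kbar_star_bags[OF k n, of "{} :: unit set"] by simp_all
    ultimately show thesis by (rule that)
  next
    case 2
    then obtain m where m: "n = 2 * m + 1" by (metis oddE)
    have n5: "5 \<le> n" using 2 n m by auto
    have "n choose 2 = n * (n div 2)" unfolding m by (simp add: choose_two)
    then have "chromatic_number (Kbar_V n 2) Kbar_E \<le> n"
      using n5 by (intro chromatic_number_Kbar_le) auto
    then show thesis using that Kbar_2_bag[OF n5] 2 by blast
  next
    case 3
    \<comment> \<open>The boundary value \<open>n = 2 * k\<close> is a multiple of \<open>k\<close>
      and thus belongs to the first case.\<close>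
    then have "2 * k < n" using n by (metis dvd_triv_right le_neq_implies_less)
    then show thesis using that Kbar_pair_bags_gain(1-3)[of k n] 3 by blast
  next
    case 4
    define p \<tau> where "p = (n - 2) div (k - 1)" and "\<tau> = ((n - 3) choose (k - 1)) div (p + 1)"
    have "\<tau> * (p + 1) \<le> (n - 3) choose (k - 1)" unfolding \<tau>_def by (rule div_times_less_eq_dividend)
    note bags = Kbar_apex_bags[OF 4(2) n p_def this]
    have "n choose k \<le> (((n - 1) choose (k - 1)) + 3 * \<tau>) * (n div k)"
      unfolding \<tau>_def p_def by (rule apex_bags_suffice[OF 4(2,3,1)])
    then have "chromatic_number (Kbar_V n k) Kbar_E \<le> ((n - 1) choose (k - 1)) + 3 * \<tau>"
      using k n by (intro chromatic_number_Kbar_le) auto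
    then show thesis using that bags by blast
  qed
qed

theorem theorem1p1:
  fixes n k :: nat
  assumes "2 \<le> k" and "2 * k \<le> n"
  shows "chromatic_number (Kbar_V n k) Kbar_E \<le> odd_hadwiger (Kbar_V n k) Kbar_E
    \<and> (\<exists>t. t \<ge> chromatic_number (Kbar_V n k) Kbar_E \<and>
           strongly_1_shallow_Kt_minor (Kbar_V n k) Kbar_E t)
    \<and> (k \<ge> 3 \<longrightarrow>
        (2 * k + 1 \<le> n \<and> n \<le> 3 * k - 2 \<longrightarrow>
           real (odd_hadwiger (Kbar_V n k) Kbar_E) - real (chromatic_number (Kbar_V n k) Kbar_E)
             \<ge> ((3/2::real) ^ (k - 1) - 8 * real k - 2) / 12)
      \<and> (n = 3 * k - 1 \<longrightarrow>
           real (odd_hadwiger (Kbar_V n k) Kbar_E) - real (chromatic_number (Kbar_V n k) Kbar_E)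
             \<ge> ((3/2::real) ^ (k - 1) - 11) / 6))"
proof -
  define h \<chi> where "h = real (odd_hadwiger (Kbar_V n k) Kbar_E)"
    and "\<chi> = real (chromatic_number (Kbar_V n k) Kbar_E)"
  define X where "X = (3/2::real) ^ (k - 1)"
  have X: "0 \<le> X" by (simp add: X_def)
  obtain t where t: "chromatic_number (Kbar_V n k) Kbar_E \<le> t"
    "strongly_1_shallow_Kt_minor (Kbar_V n k) Kbar_E t" "t \<le> odd_hadwiger (Kbar_V n k) Kbar_E"
    by (rule Kbar_minor_ge_chromatic_number[OF assms])
  \<comment> \<open>One bound for both ranges of \<open>n\<close>; the two required bounds are
    weaker, the first because \<open>X \<ge> 0\<close> and
    \<open>8 * k + 2 \<ge> 14\<close>.\<close>
  have gain: "(X - 7) / 6 \<le> h - \<chi>" if "3 \<le> k" "2 * k < n" "n < 3 * k"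
  proof -
    have "real (((n - 1) choose (k - 1)) + (((n - 1) choose k) - 2 * ((n - 1 - k) choose k)) div 3) \<le> h"
      unfolding h_def by (rule of_nat_mono[OF Kbar_pair_bags_gain(2)[OF that]])
    then show ?thesis using Kbar_pair_bags_gain(4)[OF that] unfolding \<chi>_def X_def by linarith
  qed
  have "(X - 8 * real k - 2) / 12 \<le> h - \<chi>" if "3 \<le> k" "2 * k < n" "n < 3 * k"
  proof -
    have "3 \<le> real k" using that by simp
    then show ?thesis using gain[OF that] X by argo
  qed
  moreover have "(X - 11) / 6 \<le> h - \<chi>" if "3 \<le> k" "2 * k < n" "n < 3 * k"
    using gain[OF that] by argo
  ultimately show ?thesis
    using t unfolding h_def[symmetric] \<chi>_def[symmetric] X_def[symmetric] by auto
qed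

end
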